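(* Let $\Gamma$ be a one-connected graph with two components at the cut vertex $v$, and let $\Gamma_1,\Gamma_2,\tilde\Gamma_1,\tilde\Gamma_2$ be the associated subgraphs (as defined in the context). Then $$\beta_2(D_2(\Gamma))=\beta_2(D_2(\Gamma_1))+\beta_2(D_2(\Gamma_2))+\beta_1(\tilde\Gamma_1)\beta_1(\Gamma_2)+\beta_1(\Gamma_1)\beta_1(\tilde\Gamma_2)-\beta_1(\tilde\Gamma_1)\beta_1(\tilde\Gamma_2).$$
   Context: A graph is a finite one-dimensional CW-complex. For a graph $G$, $D_2(G)$ is the cubical complex whose $k$-cells ($k=0,1,2$) are the unordered pairs $\{\sigma_1,\sigma_2\}$ of disjoint closed cells of $G$ (vertices or closed edges), exactly $k$ of which are edges. Here $\beta_p$ denotes the rank of the $p$-th homology group with integer coefficients. All graphs are assumed sufficiently subdivided for two particles, i.e. without loops or multiple edges (each path between distinct vertices of degree $\ne 2$ has at least one edge, each nontrivial loop has at least three edges). A one-connected graph with two components is a connected graph $\Gamma$ with a vertex $v$ such that removing $v$ together with the adjacent open edges leaves exactly two connected components; equivalently $\Gamma$ is a wedge sum of two connected graphs $\Gamma_1,\Gamma_2$ glued at $v$, regarded as subgraphs of $\Gamma$ with $\Gamma_1\cup\Gamma_2=\Gamma$ and $\Gamma_1\cap\Gamma_2=\{v\}$, each being the closure of one of the two components. Every edge incident to $v$ is subdivided one extra time (this subdivision is used throughout for $\Gamma$, $\Gamma_1$, $\Gamma_2$), and $\tilde\Gamma_i$ is the subgraph of $\Gamma_i$ obtained by deleting $v$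 and the open edges incident to $v$. *)

theory Defs
  imports
    "Graph_Theory.Digraph_Component"
    "HOL-Algebra.Free_Abelian_Groups"
    "HOL-Library.Product_Lexorder"
begin

section \<open>Rank of an abelian group\<close>

definition int_independent :: "('g, 'm) monoid_scheme \<Rightarrow> 'g set \<Rightarrow> bool" where
  "int_independent A S \<longleftrightarrow> finite S \<and> S \<subseteq> carrier A \<and>
     (\<forall>n :: 'g \<Rightarrow> int. finprod A (\<lambda>x. x [^]\<^bsub>A\<^esub> n x) S = \<one>\<^bsub>A\<^esub> \<longrightarrow> (\<forall>x\<in>S. n x = 0))"

text \<open>The supremum is taken in \<^typ>\<open>nat\<close>, so it is meaningful only when the rank is finite, as it is
  for homology groups of finite complexes.\<close>

definition abelian_rank :: "('g, 'm) monoid_scheme \<Rightarrow> nat" where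
  "abelian_rank A = Sup {card S | S. int_independent A S}"

section \<open>Cellular homology with integer coefficients\<close>

text \<open>A cell complex is given by its cells in each dimension, together with the cellular boundary
  of each (oriented) cell; the boundary of a 0-cell has to be 0.\<close>

record 'c cell_complex =
  cells :: "nat \<Rightarrow> 'c set"
  bdry :: "'c \<Rightarrow> ('c \<Rightarrow>\<^sub>0 int)"

definition cell_chains :: "'c cell_complex \<Rightarrow> nat \<Rightarrow> ('c \<Rightarrow>\<^sub>0 int) monoid" where
  "cell_chains K p = free_Abelian_group (cells K p)"

definition cell_cycles :: "'c cell_complex \<Rightarrow> nat \<Rightarrow> ('c \<Rightarrow>\<^sub>0 int) set" where
  "cell_cycles K p = {c \<in> carrier (cell_chains K p). frag_extend (bdry K) c = 0}"

definition cell_boundaries :: "'c cell_complex \<Rightarrow> nat \<Rightarrow> ('c \<Rightarrow>\<^sub>0 int) set" where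
  "cell_boundaries K p = frag_extend (bdry K) ` carrier (cell_chains K (Suc p))"

definition cell_homology :: "'c cell_complex \<Rightarrow> nat \<Rightarrow> ('c \<Rightarrow>\<^sub>0 int) set monoid" where
  "cell_homology K p =
     subgroup_generated (cell_chains K p) (cell_cycles K p) Mod cell_boundaries K p"

definition betti :: "nat \<Rightarrow> 'c cell_complex \<Rightarrow> nat" where
  "betti p K = abelian_rank (cell_homology K p)"

section \<open>The complexes of a graph and of its two-particle configurations\<close>

text \<open>Graphs are the finite simple graphs of the library, i.e. symmetric digraphs; an undirected edge
  is a pair of opposite arcs. A closed cell is represented by the set of its vertices: a vertex by
  \<open>{x}\<close> and an edge by \<open>{x, y}\<close>, so that two closed cells are disjoint iff these sets are.
  The linear order on the vertex type serves only to orient the cells.\<close>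

definition graph_cells :: "('a, 'b) pre_digraph \<Rightarrow> nat \<Rightarrow> 'a set set" where
  "graph_cells G k =
     (if k = 0 then {{x} | x. x \<in> verts G}
      else if k = 1 then {{tail G a, head G a} | a. a \<in> arcs G}
      else {})"

text \<open>An edge is oriented from its smaller to its larger end.\<close>

definition graph_bdry :: "'a::linorder set \<Rightarrow> ('a set \<Rightarrow>\<^sub>0 int)" where
  "graph_bdry s = (if card s = 2 then frag_of {Max s} - frag_of {Min s} else 0)"

definition graph_complex :: "('a::linorder, 'b) pre_digraph \<Rightarrow> 'a set cell_complex" where
  "graph_complex G = \<lparr>cells = graph_cells G, bdry = graph_bdry\<rparr>"

definition D2_cells :: "('a, 'b) pre_digraph \<Rightarrow> nat \<Rightarrow> 'a set set set" where
  "D2_cells G k = {{s, t} | s t i j.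
     s \<in> graph_cells G i \<and> t \<in> graph_cells G j \<and> i + j = k \<and> s \<inter> t = {}}"

text \<open>The cell \<open>{s, t}\<close> is oriented as the product \<open>s \<times> t\<close>, where \<open>s\<close> is the factor containing the
  smallest of all the vertices involved; its boundary is
  \<open>\<partial>s \<times> t + (-1)^(dim s) (s \<times> \<partial>t)\<close>. Reordering a product of two cells changes its orientation only
  if both are edges, hence the products with a vertex in the boundary carry no further sign.\<close>

definition D2_bdry :: "'a::linorder set set \<Rightarrow> ('a set set \<Rightarrow>\<^sub>0 int)" where
  "D2_bdry c =
     (let s = (THE s. s \<in> c \<and> Min (\<Union>c) \<in> s);
          t = (THE t. t \<in> c \<and> Min (\<Union>c) \<notin> t)
      in frag_extend (\<lambda>r. frag_of {r, t}) (graph_bdry s)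
         + frag_cmul ((-1) ^ (card s - 1)) (frag_extend (\<lambda>r. frag_of {s, r}) (graph_bdry t)))"

definition D2 :: "('a::linorder, 'b) pre_digraph \<Rightarrow> 'a set set cell_complex" where
  "D2 G = \<lparr>cells = D2_cells G, bdry = D2_bdry\<rparr>"

section \<open>One-connected graphs\<close>

text \<open>In a symmetric digraph the strongly connected components are the connected components. The
  closure of a component of \<open>G\<close> minus \<open>v\<close> adds \<open>v\<close> and the edges joining \<open>v\<close> to that component.\<close>

definition one_connected_two ::
  "('a, 'b) pre_digraph \<Rightarrow> 'a \<Rightarrow> ('a, 'b) pre_digraph \<Rightarrow> ('a, 'b) pre_digraph \<Rightarrow> bool" where
  "one_connected_two G v G1 G2 \<longleftrightarrow>
     graph G \<and> Digraph_Component.connected G \<and> v \<in> verts G \<and>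
     (\<exists>C1 C2. C1 \<noteq> C2 \<and> pre_digraph.sccs_verts (pre_digraph.del_vert G v) = {C1, C2} \<and>
        G1 = G \<restriction> insert v C1 \<and> G2 = G \<restriction> insert v C2)"

text \<open>Subdividing once every edge incident to \<open>v\<close>: \<open>(x, False)\<close> is the old vertex \<open>x\<close>, and
  \<open>(w, True)\<close> is the midpoint of the edge joining \<open>v\<close> and \<open>w\<close>.\<close>

definition subdivide_at ::
  "'a \<Rightarrow> ('a, 'b) pre_digraph \<Rightarrow> ('a \<times> bool, ('a \<times> bool) \<times> ('a \<times> bool)) pre_digraph" where
  "subdivide_at v G =
     \<lparr>verts = {(x, False) | x. x \<in> verts G} \<union> {(w, True) | w. (v, w) \<in> arcs_ends G},
      arcs =
        {((x, False), (y, False)) | x y. (x, y) \<in> arcs_ends G \<and> x \<noteq> v \<and> y \<noteq> v}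
        \<union> (\<Union>w \<in> {w. (v, w) \<in> arcs_ends G}.
             {((v, False), (w, True)), ((w, True), (v, False)),
              ((w, True), (w, False)), ((w, False), (w, True))}),
      tail = fst, head = snd\<rparr>"

end

theory Submission
  imports Defs
begin

text \<open>Top-dimensional homology consists of cycles. A 2-cycle of \<open>D\<^sub>2(\<Gamma>)\<close> is an antisymmetric integer
  function on the ordered pairs of edges that vanishes on pairs of non-disjoint edges and is a
  1-cycle of \<open>\<Gamma>\<close> in each argument. For a wedge, a 1-cycle splits into 1-cycles of \<open>\<Gamma>\<^sub>1\<close> and
  \<open>\<Gamma>\<^sub>2\<close>, so a 2-cycle splits into 2-cycles of \<open>D\<^sub>2(\<Gamma>\<^sub>1)\<close> and \<open>D\<^sub>2(\<Gamma>\<^sub>2)\<close> and a mixed part in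
  \<open>Z\<^sub>1(\<Gamma>\<^sub>1) \<otimes> Z\<^sub>1(\<Gamma>\<^sub>2)\<close> vanishing on pairs of edges at \<open>v\<close>. The 1-cycles vanishing on the edges at
  \<open>v\<close> are those of \<open>\<Gamma>\<close> with \<open>v\<close> deleted, so with \<open>b\<^sub>i = \<beta>\<^sub>1(\<Gamma>\<^sub>i)\<close> and \<open>b'\<^sub>i\<close> for \<open>\<Gamma>\<^sub>i\<close> minus \<open>v\<close> the
  mixed part has rank \<open>b\<^sub>1 b\<^sub>2 - (b\<^sub>1 - b'\<^sub>1) (b\<^sub>2 - b'\<^sub>2)\<close>.\<close>

section \<open>Pivots of a lattice of integer functions\<close>

definition int_submodule :: "('c \<Rightarrow> int) set \<Rightarrow> bool" where
  "int_submodule V \<longleftrightarrow> (\<forall>f\<in>V. \<forall>g\<in>V. \<forall>a b. (\<lambda>x. a * f x + b * g x) \<in> V)"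

text \<open>Reading off the values at the pivots is injective and has an image of finite index, as in an
  echelon form; so the number of pivots is the rank, and all arguments stay over the integers.\<close>

definition pivots :: "('c \<Rightarrow> int) set \<Rightarrow> 'c set \<Rightarrow> 'c set \<Rightarrow> bool" where
  "pivots V R P \<longleftrightarrow> finite P \<and> P \<subseteq> R \<and>
     (\<forall>f\<in>V. (\<forall>p\<in>P. f p = 0) \<longrightarrow> (\<forall>x\<in>R. f x = 0)) \<and>
     (\<forall>p\<in>P. \<exists>g\<in>V. g p \<noteq> 0 \<and> (\<forall>q\<in>P - {p}. g q = 0))"

lemma pivots_empty: "pivots V {} {}"
  by (simp add: pivots_def)

lemma pivots_vanish: "pivots V R P \<Longrightarrow> f \<in> V \<Longrightarrow> (\<And>p. p \<in> P \<Longrightarrow> f p = 0) \<Longrightarrow> x \<in> R \<Longrightarrow> f x = 0"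
  by (auto simp: pivots_def)

lemma pivots_dual:
  assumes "pivots V R P" "p \<in> P"
  obtains g where "g \<in> V" "g p \<noteq> 0" "\<And>q. q \<in> P \<Longrightarrow> q \<noteq> p \<Longrightarrow> g q = 0"
  using assms by (auto simp: pivots_def)

text \<open>Gaussian elimination, one coordinate at a time: \<open>e\<close> becomes a pivot exactly
  when some function of \<open>V\<close> vanishes at the earlier pivots but not at \<open>e\<close>.
  The clause \<open>P' \<inter> R = P\<close> records that new pivots arise only outside
  \<open>R\<close>.\<close>

lemma pivots_extend:
  assumes V: "int_submodule V" and "finite E" and P: "pivots V R P"
  shows "\<exists>P'. pivots V (R \<union> E) P' \<and> P' \<inter> R = P"
  using \<open>finite E\<close>
proof induction
  case empty
  then show ?case using P by (auto simp: pivots_def)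
next
  case (insert e E)
  then obtain P' where P': "pivots V (R \<union> E) P'" and "P' \<inter> R = P" by blast
  show ?case
  proof (cases "\<exists>h\<in>V. (\<forall>p\<in>P'. h p = 0) \<and> h e \<noteq> 0")
    case False
    with P' have "pivots V (R \<union> insert e E) P'"
      unfolding pivots_def by blast
    with \<open>P' \<inter> R = P\<close> show ?thesis by blast
  next
    case True
    then obtain h where h: "h \<in> V" "\<And>p. p \<in> P' \<Longrightarrow> h p = 0" "h e \<noteq> 0" by blast
    then have e: "e \<notin> P'" "e \<notin> R"
      using pivots_vanish[OF P', of h] by auto
    have "\<exists>g\<in>V. g p \<noteq> 0 \<and> (\<forall>q\<in>insert e P' - {p}. g q = 0)" if "p \<in> insert e P'" for p
    proof (cases "p = e")
      case True
      with h e show ?thesis by auto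
    next
      case False
      with that obtain g where g: "g \<in> V" "g p \<noteq> 0" "\<And>q. q \<in> P' \<Longrightarrow> q \<noteq> p \<Longrightarrow> g q = 0"
        using pivots_dual[OF P', of p] by blast
      \<comment> \<open>Cross-multiplication clears the value at \<open>e\<close> without division.
        Since \<open>h\<close> vanishes on \<open>P'\<close>, the values at the old pivots are only
        scaled by \<open>h e\<close>, which is non-zero.\<close>
      have "(\<lambda>x. h e * g x + (- g e) * h x) \<in> V"
        using V g(1) h(1) unfolding int_submodule_def by blast
      moreover have "h e * g q + (- g e) * h q = 0" if "q \<in> insert e P' - {p}" for q
        using that g(3)[of q] h(2)[of q] by auto
      ultimately show ?thesis
        using that False g(2) h
        by (intro bexI[of _ "\<lambda>x. h e * g x + (- g e) * h x"]) auto
    qed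
    moreover have "\<forall>x\<in>R \<union> insert e E. f x = 0" if "f \<in> V" "\<forall>p\<in>insert e P'. f p = 0" for f
      using pivots_vanish[OF P', of f] that by auto
    ultimately have "pivots V (R \<union> insert e E) (insert e P')"
      using P' unfolding pivots_def by blast
    with e \<open>P' \<inter> R = P\<close> show ?thesis
      by (intro exI[of _ "insert e P'"]) auto
  qed
qed

corollary pivots_exist:
  assumes "int_submodule V" "finite E"
  obtains P where "pivots V E P"
  using pivots_extend[OF assms pivots_empty] by auto

text \<open>Rank-nullity for the restriction to \<open>R\<close>: when the coordinates in
  \<open>R\<close> are eliminated first, the pivots in \<open>R\<close> count the rank of the
  restriction and the others count the rank of its kernel.\<close>

lemma pivots_adapted:
  assumes V: "int_submodule V" and "finite E" "R \<subseteq> E"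
  obtains P where "pivots V E P" "pivots V R (P \<inter> R)" "pivots {f \<in> V. \<forall>x\<in>R. f x = 0} E (P - R)"
proof -
  have "finite R" using assms finite_subset by blast
  then obtain Q where Q: "pivots V R Q" using pivots_exist[OF V] by blast
  with assms obtain P where P: "pivots V E P" "P \<inter> R = Q"
    using pivots_extend[OF V \<open>finite E\<close> Q] by (auto simp: Un_absorb1)
  have "f x = 0" if "f \<in> V" "\<forall>x\<in>R. f x = 0" "\<forall>p\<in>P - R. f p = 0" "x \<in> E" for f x
    using pivots_vanish[OF P(1)] that by blast
  moreover have "\<exists>g\<in>{f \<in> V. \<forall>x\<in>R. f x = 0}. g p \<noteq> 0 \<and> (\<forall>q\<in>P - R - {p}. g q = 0)"
    if p: "p \<in> P - R" for p
  proof -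
    obtain g where g: "g \<in> V" "g p \<noteq> 0" "\<And>q. q \<in> P \<Longrightarrow> q \<noteq> p \<Longrightarrow> g q = 0"
      using pivots_dual[OF P(1), of p] p by blast
    \<comment> \<open>The dual function of a pivot outside \<open>R\<close> is zero at all pivots in
      \<open>R\<close>, hence on all of \<open>R\<close>.\<close>
    moreover have "\<forall>x\<in>R. g x = 0"
      using pivots_vanish[OF Q] g p P(2) by blast
    ultimately show ?thesis by blast
  qed
  ultimately have "pivots {f \<in> V. \<forall>x\<in>R. f x = 0} E (P - R)"
    using P(1) unfolding pivots_def by blast
  with P Q show thesis using that by blast
qed

text \<open>A homogeneous system with fewer equations than unknowns has a non-zero integer solution;
  each induction step removes one equation and one unknown.\<close>

lemma int_dependence:
  fixes w :: "'i \<Rightarrow> 'c \<Rightarrow> int"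
  assumes "finite P" "finite I" "card P < card I"
  shows "\<exists>n. (\<exists>i\<in>I. n i \<noteq> 0) \<and> (\<forall>p\<in>P. (\<Sum>i\<in>I. n i * w i p) = 0)"
  using assms
proof (induction P arbitrary: I w)
  case empty
  then show ?case by (intro exI[of _ "\<lambda>_. 1"]) (auto simp: card_gt_0_iff)
next
  case (insert p P)
  show ?case
  proof (cases "\<forall>i\<in>I. w i p = 0")
    case True
    with insert.IH[of I w] insert.prems insert.hyps show ?thesis by auto
  next
    case False
    then obtain k where k: "k \<in> I" "w k p \<noteq> 0" by blast
    define J where "J = I - {k}"
    have J: "finite J" "card P < card J" "I = insert k J" "k \<notin> J"
      using insert k by (auto simp: J_def)
    \<comment> \<open>The vector of index \<open>k\<close> clears the coordinate \<open>p\<close>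
      from all the others, again by cross-multiplication.\<close>
    define w' where "w' = (\<lambda>i q. w k p * w i q - w i p * w k q)"
    obtain m where m: "\<exists>i\<in>J. m i \<noteq> 0" "\<And>q. q \<in> P \<Longrightarrow> (\<Sum>i\<in>J. m i * w' i q) = 0"
      using insert.IH[of J w'] J by blast
    \<comment> \<open>The coefficient at \<open>k\<close> is chosen so that the combination of the
      \<open>w i\<close> equals that of the \<open>w' i\<close> in every coordinate, including
      \<open>p\<close>, where all \<open>w' i\<close> vanish.\<close>
    define n where "n = (\<lambda>i. if i = k then - (\<Sum>i\<in>J. m i * w i p) else w k p * m i)"
    have "(\<Sum>i\<in>I. n i * w i q) = (\<Sum>i\<in>J. m i * w' i q)" for q
    proof -
      have "(\<Sum>i\<in>J. n i * w i q) = (\<Sum>i\<in>J. w k p * m i * w i q)"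
        using J(4) by (intro sum.cong) (auto simp: n_def)
      then show ?thesis
        using J by (simp add: n_def w'_def algebra_simps sum_subtractf sum_distrib_left)
    qed
    moreover have "(\<Sum>i\<in>J. m i * w' i p) = 0"
      by (simp add: w'_def algebra_simps)
    moreover have "\<exists>i\<in>I. n i \<noteq> 0"
      using m(1) J k by (auto simp: n_def)
    ultimately show ?thesis using m(2) by (intro exI[of _ n]) auto
  qed
qed

section \<open>Betti numbers in the top dimension\<close>

definition cycle_functions :: "'c cell_complex \<Rightarrow> nat \<Rightarrow> ('c \<Rightarrow> int) set" where
  "cycle_functions K p = {f. (\<forall>c. c \<notin> cells K p \<longrightarrow> f c = 0) \<and>
     (\<forall>d. (\<Sum>c\<in>cells K p. f c * poly_mapping.lookup (bdry K c) d) = 0)}"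

lemma cell_cycles_iff:
  assumes "finite (cells K p)"
  shows "c \<in> cell_cycles K p \<longleftrightarrow> poly_mapping.lookup c \<in> cycle_functions K p"
proof -
  have "poly_mapping.lookup (frag_extend (bdry K) c) d =
      (\<Sum>x\<in>cells K p. poly_mapping.lookup c x * poly_mapping.lookup (bdry K x) d)"
    if "Poly_Mapping.keys c \<subseteq> cells K p" for d
  proof -
    have "poly_mapping.lookup (frag_extend (bdry K) c) d =
        (\<Sum>x\<in>Poly_Mapping.keys c. poly_mapping.lookup c x * poly_mapping.lookup (bdry K x) d)"
      by (simp add: frag_extend_def lookup_sum)
    also have "\<dots> = (\<Sum>x\<in>cells K p. poly_mapping.lookup c x * poly_mapping.lookup (bdry K x) d)"
      using assms that by (intro sum.mono_neutral_left) (auto simp: in_keys_iff)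
    finally show ?thesis .
  qed
  moreover have "Poly_Mapping.keys c \<subseteq> cells K p \<longleftrightarrow> (\<forall>x. x \<notin> cells K p \<longrightarrow> poly_mapping.lookup c x = 0)"
    by (auto simp: in_keys_iff)
  ultimately show ?thesis
    unfolding cell_cycles_def cell_chains_def cycle_functions_def poly_mapping_eq_iff fun_eq_iff
    by (simp cong: conj_cong)
qed

lemma cycle_functions_lift:
  assumes "finite (cells K p)" "f \<in> cycle_functions K p"
  obtains c where "c \<in> cell_cycles K p" "poly_mapping.lookup c = f"
proof -
  have "finite {x. f x \<noteq> 0}"
    using assms by (auto simp: cycle_functions_def intro: finite_subset[of _ "cells K p"])
  then have "poly_mapping.lookup (Abs_poly_mapping f) = f"
    by simp
  with that show thesis using assms cell_cycles_iff by metis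
qed

text \<open>Without cells one dimension higher the only boundary is 0, so every coset is a singleton
  and the homology group is a copy of the group of cycles.\<close>

lemma int_independent_top_homology:
  fixes K :: "'c cell_complex"
  assumes top: "cells K (Suc p) = {}"
  shows "int_independent (cell_homology K p) S \<longleftrightarrow>
    (\<exists>T. finite T \<and> T \<subseteq> cell_cycles K p \<and> S = (\<lambda>z. {z}) ` T \<and>
      (\<forall>n. (\<Sum>z\<in>T. frag_cmul (n z) z) = 0 \<longrightarrow> (\<forall>z\<in>T. n z = 0)))"
proof -
  let ?F = "free_Abelian_group (cells K p)" and ?Z = "cell_cycles K p" and ?s = "\<lambda>z :: 'c \<Rightarrow>\<^sub>0 int. {z}"
  interpret F: comm_group ?F by (rule abelian_free_Abelian_group)
  have "subgroup ?Z ?F"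
    by (rule F.subgroupI)
      (auto simp: cell_cycles_def cell_chains_def frag_extend_add frag_extend_minus
        dest!: subsetD[OF keys_add] intro: exI[of _ 0])
  define A where "A = subgroup_generated ?F ?Z"
  interpret A: comm_group A unfolding A_def by (rule F.abelian_subgroup_generated[OF abelian_free_Abelian_group])
  have A: "carrier A = ?Z" "\<And>x y. x \<otimes>\<^bsub>A\<^esub> y = x + y" "\<one>\<^bsub>A\<^esub> = 0"
    by (simp_all add: A_def subgroup.carrier_subgroup_generated_subgroup[OF \<open>subgroup ?Z ?F\<close>])
  have B: "cell_boundaries K p = {0}"
    using top by (auto simp: cell_boundaries_def cell_chains_def)
  define H where "H = cell_homology K p"
  have H_eq: "H = A Mod {0}"
    by (simp add: H_def cell_homology_def A_def B cell_chains_def)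
  have "subgroup {0} A"
    using A.triv_subgroup A(3) by simp
  then have "comm_group H" unfolding H_eq by (rule A.abelian_FactGroup)
  then interpret H: comm_group H .
  have H: "carrier H = ?s ` ?Z" "\<And>x y. {x} \<otimes>\<^bsub>H\<^esub> {y} = {x + y}" "\<one>\<^bsub>H\<^esub> = {0}"
    by (auto simp: H_eq FactGroup_def RCOSETS_def r_coset_def set_mult_def A)
  have hom: "?s \<in> hom A H" "id \<in> hom A ?F"
    using A H by (auto simp: hom_def cell_cycles_def cell_chains_def)
  \<comment> \<open>Powers are carried along the singleton homomorphism and the inclusion into the
    free abelian group, where they are integer multiples of chains.\<close>
  have pow: "{z} [^]\<^bsub>H\<^esub> (k::int) = {frag_cmul k z}" if "z \<in> ?Z" for z k
  proof -
    have "{z} [^]\<^bsub>H\<^esub> k = {z [^]\<^bsub>A\<^esub> k}"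
      using hom_int_pow[OF hom(1) _ A.is_group H.is_group] that A by simp
    also have "z [^]\<^bsub>A\<^esub> k = z [^]\<^bsub>?F\<^esub> k"
      using hom_int_pow[OF hom(2) _ A.is_group F.is_group, of z k] that A by simp
    also have "\<dots> = frag_cmul k z"
      using that by (intro int_pow_free_Abelian_group) (auto simp: cell_cycles_def cell_chains_def)
    finally show ?thesis .
  qed
  have prod: "finprod H (\<lambda>x. x [^]\<^bsub>H\<^esub> n x) (?s ` T) = {\<Sum>z\<in>T. frag_cmul (n {z}) z}"
    if "finite T" "T \<subseteq> ?Z" for T and n :: "_ \<Rightarrow> int"
    using that
  proof induction
    case empty
    then show ?case by (simp add: H)
  next
    case (insert z T)
    then have closed: "{y} [^]\<^bsub>H\<^esub> k \<in> carrier H" if "y \<in> insert z T" for y and k :: int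
      using that by (intro H.int_pow_closed) (auto simp: H(1))
    moreover have "{frag_cmul (n {z}) z} \<in> carrier H"
      using closed[of z "n {z}"] insert.prems by (simp add: pow)
    ultimately show ?case
      using insert
      by (subst image_insert, subst H.finprod_insert) (auto simp: pow H(2))
  qed
  show ?thesis unfolding H_def[symmetric]
  proof
    assume S: "int_independent H S"
    then have ind: "\<forall>x\<in>S. m x = 0" if "finprod H (\<lambda>x. x [^]\<^bsub>H\<^esub> m x) S = \<one>\<^bsub>H\<^esub>" for m :: "_ \<Rightarrow> int"
      using that by (simp add: int_independent_def)
    from S have "finite S" "S \<subseteq> ?s ` ?Z" by (simp_all add: int_independent_def H(1))
    then obtain T where T: "finite T" "T \<subseteq> ?Z" "S = ?s ` T"
      by (meson finite_subset_image)
    have "\<forall>z\<in>T. n z = 0" if "(\<Sum>z\<in>T. frag_cmul (n z) z) = 0" for n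
    proof -
      \<comment> \<open>\<open>the_elem\<close> turns coefficients indexed by cycles into
        coefficients indexed by cosets.\<close>
      have "finprod H (\<lambda>x. x [^]\<^bsub>H\<^esub> (n (the_elem x))) S = \<one>\<^bsub>H\<^esub>"
        using prod[OF T(1,2), of "\<lambda>x. n (the_elem x)"] that by (simp add: T(3) H(3))
      then have "\<forall>x\<in>S. n (the_elem x) = 0"
        by (rule ind)
      then show ?thesis by (simp add: T)
    qed
    with T show "\<exists>T. finite T \<and> T \<subseteq> ?Z \<and> S = ?s ` T \<and>
      (\<forall>n. (\<Sum>z\<in>T. frag_cmul (n z) z) = 0 \<longrightarrow> (\<forall>z\<in>T. n z = 0))" by blast
  next
    assume "\<exists>T. finite T \<and> T \<subseteq> ?Z \<and> S = ?s ` T \<and>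
      (\<forall>n. (\<Sum>z\<in>T. frag_cmul (n z) z) = 0 \<longrightarrow> (\<forall>z\<in>T. n z = 0))"
    then obtain T where T: "finite T" "T \<subseteq> ?Z" "S = ?s ` T"
      "\<And>n. (\<Sum>z\<in>T. frag_cmul (n z) z) = 0 \<Longrightarrow> \<forall>z\<in>T. n z = 0" by blast
    show "int_independent H S"
      unfolding int_independent_def
    proof (intro conjI allI impI)
      fix n :: "_ \<Rightarrow> int"
      assume "finprod H (\<lambda>x. x [^]\<^bsub>H\<^esub> n x) S = \<one>\<^bsub>H\<^esub>"
      then have "(\<Sum>z\<in>T. frag_cmul (n {z}) z) = 0"
        using prod[OF T(1,2), of n] by (simp add: T(3) H(3))
      then show "\<forall>x\<in>S. n x = 0" using T(4)[of "\<lambda>z. n {z}"] T(3) by simp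
    qed (use T(1-3) H(1) in auto)
  qed
qed

text \<open>Cycles dual to the pivots are independent, which gives the lower bound. For the upper
  bound, the values at the pivots embed the cycles into the integer functions on
  \<open>P\<close>.\<close>

lemma betti_eq_card_pivots:
  assumes fin: "finite (cells K p)" and top: "cells K (Suc p) = {}"
    and P: "pivots (cycle_functions K p) (cells K p) P"
  shows "betti p K = card P"
  unfolding betti_def abelian_rank_def
\<comment> \<open>The number of pivots is both attained and an upper bound, so the supremum in
  \<open>nat\<close> is a genuine maximum.\<close>
proof (rule cSup_eq_maximum)
  have "finite P" using P by (simp add: pivots_def)
  have "\<exists>z. z \<in> cell_cycles K p \<and> poly_mapping.lookup z q \<noteq> 0 \<and>
      (\<forall>r\<in>P. r \<noteq> q \<longrightarrow> poly_mapping.lookup z r = 0)" if q: "q \<in> P" for q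
  proof -
    obtain g where g: "g \<in> cycle_functions K p" "g q \<noteq> 0" "\<And>r. r \<in> P \<Longrightarrow> r \<noteq> q \<Longrightarrow> g r = 0"
      using pivots_dual[OF P q] by blast
    obtain z where "z \<in> cell_cycles K p" "poly_mapping.lookup z = g"
      using cycle_functions_lift[OF fin g(1)] by blast
    with g show ?thesis by blast
  qed
  then obtain z where z: "\<And>q. q \<in> P \<Longrightarrow> z q \<in> cell_cycles K p"
    "\<And>q. q \<in> P \<Longrightarrow> poly_mapping.lookup (z q) q \<noteq> 0"
    "\<And>q r. q \<in> P \<Longrightarrow> r \<in> P \<Longrightarrow> r \<noteq> q \<Longrightarrow> poly_mapping.lookup (z q) r = 0"
    by metis
  have "inj_on z P"
    by (rule inj_onI) (metis z(2,3))
  have "n (z r) = 0" if n: "(\<Sum>x\<in>z ` P. frag_cmul (n x) x) = 0" and r: "r \<in> P" for n r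
  proof -
    have "0 = poly_mapping.lookup (\<Sum>x\<in>z ` P. frag_cmul (n x) x) r"
      by (simp add: n)
    also have "\<dots> = (\<Sum>q\<in>P. n (z q) * poly_mapping.lookup (z q) r)"
      using \<open>inj_on z P\<close> by (simp add: lookup_sum sum.reindex)
    also have "\<dots> = (\<Sum>q\<in>{r}. n (z q) * poly_mapping.lookup (z q) r)"
      using \<open>finite P\<close> r z(3) by (intro sum.mono_neutral_right) auto
    finally show ?thesis using z(2) r by simp
  qed
  then have "int_independent (cell_homology K p) ((\<lambda>z. {z}) ` z ` P)"
    unfolding int_independent_top_homology[OF top]
    using \<open>finite P\<close> z(1) by (intro exI[of _ "z ` P"]) auto
  moreover have "card ((\<lambda>z. {z}) ` z ` P) = card P"
    using \<open>inj_on z P\<close> by (simp add: card_image)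
  ultimately show "card P \<in> {card S |S. int_independent (cell_homology K p) S}"
    by (metis (mono_tags, lifting) mem_Collect_eq)
next
  fix k assume "k \<in> {card S |S. int_independent (cell_homology K p) S}"
  then obtain T where T: "finite T" "T \<subseteq> cell_cycles K p" "k = card ((\<lambda>z. {z}) ` T)"
    and ind: "\<And>n. (\<Sum>z\<in>T. frag_cmul (n z) z) = 0 \<Longrightarrow> \<forall>z\<in>T. n z = 0"
    unfolding int_independent_top_homology[OF top] by auto
  have k: "k = card T" by (simp add: T(3) card_image)
  show "k \<le> card P"
  proof (rule ccontr)
    assume "\<not> k \<le> card P"
    \<comment> \<open>More cycles than pivots admit a non-trivial relation between their values at
      the pivots. The combination \<open>?s\<close> is then a cycle vanishing at all pivots, hence
      0.\<close>
    then obtain n where n: "\<exists>z\<in>T. n z \<noteq> 0"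
      "\<And>p. p \<in> P \<Longrightarrow> (\<Sum>z\<in>T. n z * poly_mapping.lookup z p) = 0"
      using int_dependence[of P T poly_mapping.lookup] P T(1) k by (auto simp: pivots_def)
    let ?s = "\<Sum>z\<in>T. frag_cmul (n z) z"
    have "?s \<in> cell_cycles K p"
      using T(1,2)
    proof (induction)
      case empty
      then show ?case by (simp add: cell_cycles_def cell_chains_def)
    next
      case (insert z T)
      then show ?case
        by (auto simp: cell_cycles_def cell_chains_def frag_extend_add frag_extend_cmul
            dest!: subsetD[OF keys_add] subsetD[OF keys_cmul])
    qed
    then have s: "poly_mapping.lookup ?s \<in> cycle_functions K p"
      using cell_cycles_iff[OF fin] by blast
    have "poly_mapping.lookup ?s x = 0" for x
    proof (cases "x \<in> cells K p")
      case True
      then show ?thesis using pivots_vanish[OF P s] n(2) by (simp add: lookup_sum)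
    qed (use s in \<open>simp add: cycle_functions_def\<close>)
    then have "?s = 0" by (simp add: poly_mapping_eq_iff fun_eq_iff)
    with ind n(1) show False by blast
  qed
qed

section \<open>Cycles of a graph and of its configuration space\<close>

definition incidence :: "'a::linorder set \<Rightarrow> 'a \<Rightarrow> int" where
  "incidence e x = poly_mapping.lookup (graph_bdry e) {x}"

lemma incidence_eq:
  "card e = 2 \<Longrightarrow> incidence e x = of_bool (x = Max e) - of_bool (x = Min e)"
  by (auto simp: incidence_def graph_bdry_def lookup_frag_of lookup_minus)

lemma card_2_finite: "card e = 2 \<Longrightarrow> finite e \<and> e \<noteq> {}"
  by (metis card.empty card.infinite zero_neq_numeral)

lemma Max_Min_in_card_2: "card e = 2 \<Longrightarrow> Max e \<in> e \<and> Min e \<in> e"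
  by (simp add: card_2_finite)

lemma incidence_outside: "card e = 2 \<Longrightarrow> x \<notin> e \<Longrightarrow> incidence e x = 0"
  using Max_Min_in_card_2[of e] by (auto simp: incidence_eq)

text \<open>The two ends of \<open>e\<close> contribute 1 and -1: the augmentation kills boundaries.
  This settles the cycle condition at the cut vertex of a wedge.\<close>

lemma sum_incidence:
  assumes "card e = 2" "e \<subseteq> X" "finite X"
  shows "(\<Sum>x\<in>X. incidence e x) = 0"
proof -
  have "Max e \<in> X" "Min e \<in> X"
    using assms Max_Min_in_card_2[of e] by auto
  then show ?thesis
    using assms by (simp add: incidence_eq sum_subtractf of_bool_def)
qed

text \<open>Functions are extended by zero outside \<open>E\<close>, so that the cycles of a
  subgraph are literally cycles of the larger graph.\<close>

definition edge_cycles :: "'a::linorder set set \<Rightarrow> ('a set \<Rightarrow> int) set" where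
  "edge_cycles E = {g. (\<forall>e. e \<notin> E \<longrightarrow> g e = 0) \<and> (\<forall>x. (\<Sum>e\<in>E. g e * incidence e x) = 0)}"

lemma edge_cycles_smult: "g \<in> edge_cycles E \<Longrightarrow> (\<lambda>e. k * g e) \<in> edge_cycles E"
  by (auto simp: edge_cycles_def mult.assoc simp flip: sum_distrib_left)

lemma edge_cycles_zero: "(\<lambda>_. 0) \<in> edge_cycles E"
  by (simp add: edge_cycles_def)

lemma edge_cycles_mono:
  assumes "finite E'" "E \<subseteq> E'"
  shows "edge_cycles E = {g \<in> edge_cycles E'. \<forall>e\<in>E' - E. g e = 0}"
proof -
  have "(\<Sum>e\<in>E. g e * incidence e x) = (\<Sum>e\<in>E'. g e * incidence e x)"
    if "\<forall>e\<in>E' - E. g e = 0" for g x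
    using assms that by (intro sum.mono_neutral_left) auto
  then show ?thesis
    using assms(2) by (auto simp: edge_cycles_def)
qed

lemma cycle_functions_graph:
  assumes "\<And>e. e \<in> graph_cells G 1 \<Longrightarrow> card e = 2"
  shows "cycle_functions (graph_complex G) 1 = edge_cycles (graph_cells G 1)"
proof -
  let ?E = "graph_cells G 1"
  have "(\<Sum>e\<in>?E. g e * poly_mapping.lookup (graph_bdry e) d) = 0"
    if "\<forall>x. (\<Sum>e\<in>?E. g e * incidence e x) = 0" for g d
  proof (cases "\<exists>x. d = {x}")
    case True
    with that show ?thesis by (auto simp: incidence_def)
  next
    \<comment> \<open>A set that is not a singleton has coefficient 0 in the boundary of every edge,
      so only vertices impose conditions.\<close>
    case False
    then show ?thesis
      using assms by (intro sum.neutral) (auto simp: graph_bdry_def lookup_frag_of lookup_minus)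
  qed
  then show ?thesis
    by (auto simp: cycle_functions_def edge_cycles_def graph_complex_def incidence_def)
qed

section \<open>Pairs of disjoint edges and the 2-cycles of the configuration space\<close>

definition disjoint_pairs :: "'a set set \<Rightarrow> 'a set set set" where
  "disjoint_pairs E = {{s, t} | s t. s \<in> E \<and> t \<in> E \<and> s \<inter> t = {}}"

lemma disjoint_pairs_mono: "E \<subseteq> E' \<Longrightarrow> disjoint_pairs E \<subseteq> disjoint_pairs E'"
  unfolding disjoint_pairs_def by blast

lemma finite_disjoint_pairs: "finite E \<Longrightarrow> finite (disjoint_pairs E)"
  by (rule finite_subset[of _ "Pow E"]) (auto simp: disjoint_pairs_def)

lemma doubleton_in_disjoint_pairs: "{s, t} \<in> disjoint_pairs E \<longleftrightarrow> s \<in> E \<and> t \<in> E \<and> s \<inter> t = {}"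
  by (auto simp: disjoint_pairs_def doubleton_eq_iff)

lemma D2_cells_2: "D2_cells G 2 = disjoint_pairs (graph_cells G 1)"
proof
  show "D2_cells G 2 \<subseteq> disjoint_pairs (graph_cells G 1)"
  proof
    fix c assume "c \<in> D2_cells G 2"
    then obtain s t i j where c: "c = {s, t}" "s \<in> graph_cells G i" "t \<in> graph_cells G j"
      "i + j = 2" "s \<inter> t = {}"
      unfolding D2_cells_def by blast
    moreover from c have "i \<le> 1" "j \<le> 1"
      by (auto simp: graph_cells_def split: if_splits)
    with c(4) have "i = 1" "j = 1" by auto
    ultimately show "c \<in> disjoint_pairs (graph_cells G 1)"
      unfolding disjoint_pairs_def by blast
  qed
  have "1 + 1 = (2::nat)" by simp
  then show "disjoint_pairs (graph_cells G 1) \<subseteq> D2_cells G 2"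
    unfolding D2_cells_def disjoint_pairs_def by blast
qed

lemma D2_cells_3: "D2_cells G (Suc 2) = {}"
  by (auto simp: D2_cells_def graph_cells_def split: if_splits)

text \<open>For disjoint edges this is the sign of the product \<open>s\<close> times
  \<open>t\<close> relative to the orientation used by \<open>D2_bdry\<close>, which puts the factor
  with the smallest vertex first.\<close>

definition orientation :: "'a::linorder set \<Rightarrow> 'a set \<Rightarrow> int" where
  "orientation s t = (if Min (s \<union> t) \<in> s then 1 else -1)"

lemma orientation_swap:
  assumes "card s = 2" "card t = 2" "s \<inter> t = {}"
  shows "orientation t s = - orientation s t"
proof -
  have "Min (s \<union> t) \<in> s \<union> t"
    using card_2_finite assms by (intro Min_in) auto
  with assms(3) show ?thesis
    by (auto simp: orientation_def Un_commute)
qed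

text \<open>The part of the boundary of the product in which only \<open>s\<close> is replaced by
  its ends; \<open>half_bdry t s\<close> supplies the other part.\<close>

definition half_bdry :: "'a::linorder set \<Rightarrow> 'a set \<Rightarrow> ('a set set \<Rightarrow>\<^sub>0 int)" where
  "half_bdry s t = frag_of {{Max s}, t} - frag_of {{Min s}, t}"

text \<open>The cardinalities keep edges apart from singletons, so an unordered pair of a vertex and
  an edge determines which member is which.\<close>

lemma lookup_half_bdry:
  assumes "card s = 2" "card t = 2" "card u = 2"
  shows "poly_mapping.lookup (half_bdry s t) {{x}, u} = (if t = u then incidence s x else 0)"
proof -
  have "t \<noteq> {y}" "u \<noteq> {y}" for y using assms by auto
  then have "{{x}, u} = {{y}, t} \<longleftrightarrow> x = y \<and> t = u" for y
    by (auto simp: doubleton_eq_iff)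
  then have "poly_mapping.lookup (frag_of {{y}, t}) {{x}, u} = of_bool (x = y \<and> t = u)" for y
    by (simp only: lookup_frag_of of_bool_def)
  then show ?thesis
    using assms by (simp add: half_bdry_def lookup_minus incidence_eq)
qed

text \<open>The sign -1 in the product rule for an edge \<open>s\<close> equals the orientation of
  the swapped pair. This makes the formula symmetric, so it suffices to treat the case where the
  smallest vertex lies in \<open>s\<close>.\<close>

lemma D2_bdry_edges:
  assumes "card s = 2" "card t = 2" "s \<inter> t = {}"
  shows "D2_bdry {s, t} =
    frag_cmul (orientation s t) (half_bdry s t) + frag_cmul (orientation t s) (half_bdry t s)"
proof -
  have *: "D2_bdry {s, t} =
      frag_cmul (orientation s t) (half_bdry s t) + frag_cmul (orientation t s) (half_bdry t s)"
    if c: "card s = 2" "card t = 2" "s \<inter> t = {}" and m: "Min (s \<union> t) \<in> s" for s t :: "'a set"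
  proof -
    have "Min (s \<union> t) \<notin> t" using c m by auto
    then have "(THE r. r \<in> {s, t} \<and> Min (\<Union>{s, t}) \<in> r) = s"
      "(THE r. r \<in> {s, t} \<and> Min (\<Union>{s, t}) \<notin> r) = t"
      using m by (auto intro!: the_equality)
    moreover have "orientation s t = 1" "orientation t s = -1"
      using m orientation_swap[OF c] by (auto simp: orientation_def)
    ultimately show ?thesis
      using c insert_commute[of s "{Max t}" "{}"] insert_commute[of s "{Min t}" "{}"]
      by (simp add: D2_bdry_def Let_def graph_bdry_def half_bdry_def frag_extend_diff)
  qed
  have "Min (s \<union> t) \<in> s \<union> t"
    using card_2_finite assms by (intro Min_in) auto
  then consider "Min (s \<union> t) \<in> s" | "Min (t \<union> s) \<in> t"
    by (auto simp: Un_commute)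
  then show ?thesis
  proof cases
    case 1
    then show ?thesis using * assms by blast
  next
    case 2
    have "t \<inter> s = {}" "{s, t} = {t, s}" using assms(3) by auto
    with *[of t s] assms 2 show ?thesis
      by (simp only: add.commute)
  qed
qed

text \<open>The orientation sign makes the function antisymmetric in the two edges; it turns the boundary
  condition of \<open>D2\<close> into the cycle condition for each slice.\<close>

definition pair_cycles :: "'a::linorder set set \<Rightarrow> ('a set set \<Rightarrow> int) set" where
  "pair_cycles E = {f. (\<forall>c. c \<notin> disjoint_pairs E \<longrightarrow> f c = 0) \<and>
     (\<forall>u\<in>E. (\<lambda>e. orientation e u * f {e, u}) \<in> edge_cycles E)}"

text \<open>The boundary coefficient at the 1-cell \<open>{{x}, u}\<close> only sees pairs
  \<open>{e, u}\<close>. It is the boundary coefficient at \<open>x\<close> of the signed slice at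
  \<open>u\<close>.\<close>

lemma cycle_functions_D2:
  fixes G :: "('a::linorder, 'b) pre_digraph"
  assumes fin: "finite (graph_cells G 1)" and card: "\<And>e. e \<in> graph_cells G 1 \<Longrightarrow> card e = 2"
  shows "cycle_functions (D2 G) 2 = pair_cycles (graph_cells G 1)"
proof -
  let ?E = "graph_cells G 1"
  let ?D = "disjoint_pairs ?E"
  define S where "S f d = (\<Sum>c\<in>?D. f c * poly_mapping.lookup (D2_bdry c) d)" for f d
  have edge: "S f {{x}, u} = (\<Sum>e\<in>?E. (orientation e u * f {e, u}) * incidence e x)"
    if f: "\<forall>c. c \<notin> ?D \<longrightarrow> f c = 0" and u: "u \<in> ?E" for f x u
  proof -
    let ?N = "{e \<in> ?E. e \<inter> u = {}}"
    have "S f {{x}, u} =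
        (\<Sum>c\<in>(\<lambda>e. {e, u}) ` ?N. f c * poly_mapping.lookup (D2_bdry c) {{x}, u})"
      unfolding S_def
    proof (rule sum.mono_neutral_right)
      show "finite ?D" using fin by (rule finite_disjoint_pairs)
      show "(\<lambda>e. {e, u}) ` ?N \<subseteq> ?D" using u by (auto simp: doubleton_in_disjoint_pairs)
      show "\<forall>c\<in>?D - (\<lambda>e. {e, u}) ` ?N. f c * poly_mapping.lookup (D2_bdry c) {{x}, u} = 0"
      proof
        fix c assume c: "c \<in> ?D - (\<lambda>e. {e, u}) ` ?N"
        then obtain s t where st: "c = {s, t}" "s \<in> ?E" "t \<in> ?E" "s \<inter> t = {}"
          unfolding disjoint_pairs_def by blast
        have "u \<noteq> s" "u \<noteq> t" using c st by auto
        then show "f c * poly_mapping.lookup (D2_bdry c) {{x}, u} = 0"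
          using st u card by (simp add: D2_bdry_edges lookup_add lookup_half_bdry)
      qed
    qed
    also have "\<dots> = (\<Sum>e\<in>?N. f {e, u} * poly_mapping.lookup (D2_bdry {e, u}) {{x}, u})"
      by (subst sum.reindex) (auto simp: inj_on_def doubleton_eq_iff)
    also have "\<dots> = (\<Sum>e\<in>?N. (orientation e u * f {e, u}) * incidence e x)"
    proof (rule sum.cong)
      fix e assume e: "e \<in> ?N"
      then have "e \<noteq> u" using card[OF u] by auto
      with e u card show "f {e, u} * poly_mapping.lookup (D2_bdry {e, u}) {{x}, u} =
          (orientation e u * f {e, u}) * incidence e x"
        by (simp add: D2_bdry_edges lookup_add lookup_half_bdry)
    qed simp
    \<comment> \<open>On pairs of edges that meet, \<open>f\<close> is 0 by its support condition,
      so the sum may run over all edges.\<close>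
    also have "\<dots> = (\<Sum>e\<in>?E. (orientation e u * f {e, u}) * incidence e x)"
      using fin f by (intro sum.mono_neutral_left) (auto simp: doubleton_in_disjoint_pairs)
    finally show ?thesis .
  qed
  have other: "S f d = 0" if d: "\<And>x u. u \<in> ?E \<Longrightarrow> d \<noteq> {{x}, u}" for f d
    unfolding S_def
  proof (rule sum.neutral, rule ballI)
    fix c assume "c \<in> ?D"
    then obtain s t where st: "c = {s, t}" "s \<in> ?E" "t \<in> ?E" "s \<inter> t = {}"
      unfolding disjoint_pairs_def by blast
    then have "poly_mapping.lookup (half_bdry s t) d = 0" "poly_mapping.lookup (half_bdry t s) d = 0"
      using d by (auto simp: half_bdry_def lookup_minus lookup_frag_of)
    with st card show "f c * poly_mapping.lookup (D2_bdry c) d = 0"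
      by (simp add: D2_bdry_edges lookup_add)
  qed
  have "(\<forall>d. S f d = 0) \<longleftrightarrow> (\<forall>u\<in>?E. (\<lambda>e. orientation e u * f {e, u}) \<in> edge_cycles ?E)"
    if f: "\<forall>c. c \<notin> ?D \<longrightarrow> f c = 0" for f
  proof -
    have "(\<forall>d. S f d = 0) \<longleftrightarrow> (\<forall>u\<in>?E. \<forall>x. S f {{x}, u} = 0)"
      using other[of _ f] by metis
    also have "\<dots> \<longleftrightarrow> (\<forall>u\<in>?E. (\<lambda>e. orientation e u * f {e, u}) \<in> edge_cycles ?E)"
      using edge[OF f] f by (auto simp: edge_cycles_def doubleton_in_disjoint_pairs)
    finally show ?thesis .
  qed
  then show ?thesis
    unfolding cycle_functions_def pair_cycles_def S_def
    by (auto simp: D2_def D2_cells_2)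
qed

section \<open>Betti numbers of graphs and configuration spaces by pivots\<close>

lemma betti_graph_complex:
  assumes fin: "finite (graph_cells G 1)" and card: "\<And>e. e \<in> graph_cells G 1 \<Longrightarrow> card e = 2"
    and P: "pivots (edge_cycles (graph_cells G 1)) (graph_cells G 1) P"
  shows "betti 1 (graph_complex G) = card P"
proof (rule betti_eq_card_pivots)
  have cells: "cells (graph_complex G) = graph_cells G"
    by (simp add: graph_complex_def)
  show "finite (cells (graph_complex G) 1)" unfolding cells by (rule fin)
  show "cells (graph_complex G) (Suc 1) = {}" unfolding cells by (simp add: graph_cells_def)
  have "cycle_functions (graph_complex G) 1 = edge_cycles (graph_cells G 1)"
    using card by (rule cycle_functions_graph)
  with P show "pivots (cycle_functions (graph_complex G) 1) (cells (graph_complex G) 1) P"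
    unfolding cells by simp
qed

lemma betti_D2:
  assumes fin: "finite (graph_cells G 1)" and card: "\<And>e. e \<in> graph_cells G 1 \<Longrightarrow> card e = 2"
    and F: "pivots (pair_cycles (graph_cells G 1)) (disjoint_pairs (graph_cells G 1)) F"
  shows "betti 2 (D2 G) = card F"
proof (rule betti_eq_card_pivots)
  have cells: "cells (D2 G) = D2_cells G"
    by (simp add: D2_def)
  show "finite (cells (D2 G) 2)" unfolding cells D2_cells_2 by (rule finite_disjoint_pairs[OF fin])
  show "cells (D2 G) (Suc 2) = {}" unfolding cells by (rule D2_cells_3)
  have "cycle_functions (D2 G) 2 = pair_cycles (graph_cells G 1)"
    using fin card by (rule cycle_functions_D2)
  with F show "pivots (cycle_functions (D2 G) 2) (cells (D2 G) 2) F"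
    unfolding cells D2_cells_2 by simp
qed

lemma int_submodule_edge_cycles: "int_submodule (edge_cycles E)"
  by (auto simp: int_submodule_def edge_cycles_def distrib_right sum.distrib mult.assoc
      simp flip: sum_distrib_left)

lemma int_submodule_pair_cycles: "int_submodule (pair_cycles E)"
  unfolding int_submodule_def
proof (intro ballI allI)
  fix f g a b assume f: "f \<in> pair_cycles E" and g: "g \<in> pair_cycles E"
  have "(\<lambda>e. orientation e u * (a * f {e, u} + b * g {e, u})) \<in> edge_cycles E" if "u \<in> E" for u
  proof -
    have "(\<lambda>e. a * (orientation e u * f {e, u}) + b * (orientation e u * g {e, u})) \<in> edge_cycles E"
    proof -
      have "(\<lambda>e. orientation e u * f {e, u}) \<in> edge_cycles E"
        "(\<lambda>e. orientation e u * g {e, u}) \<in> edge_cycles E"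
        using f g that by (auto simp: pair_cycles_def)
      then show ?thesis
        using int_submodule_edge_cycles[of E] by (simp add: int_submodule_def)
    qed
    then show ?thesis by (simp add: algebra_simps)
  qed
  with f g show "(\<lambda>x. a * f x + b * g x) \<in> pair_cycles E"
    by (auto simp: pair_cycles_def)
qed

lemma orientation_cancel: "orientation s t * (orientation s t * x) = x"
  by (simp add: orientation_def)

lemma orientation_nonzero [simp]: "orientation s t \<noteq> 0"
  by (simp add: orientation_def)

section \<open>Wedge sums\<close>

text \<open>Edges are sets of two vertices; \<open>E\<^sub>1\<close> and \<open>E\<^sub>2\<close> are the edge sets of two graphs glued at \<open>v\<close>.\<close>

locale wedge =
  fixes E\<^sub>1 E\<^sub>2 :: "'a::linorder set set" and v :: 'a
  assumes finite_left: "finite E\<^sub>1" and finite_right: "finite E\<^sub>2"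
    and card_left: "e \<in> E\<^sub>1 \<Longrightarrow> card e = 2" and card_right: "e \<in> E\<^sub>2 \<Longrightarrow> card e = 2"
    and meet: "a \<in> E\<^sub>1 \<Longrightarrow> b \<in> E\<^sub>2 \<Longrightarrow> a \<inter> b \<subseteq> {v}"
begin

text \<open>Through an interpretation with exchanged roles, every lemma on the left summand also
  serves for the right one.\<close>

lemma wedge_swap: "wedge E\<^sub>2 E\<^sub>1 v"
proof
  show "a \<inter> b \<subseteq> {v}" if "a \<in> E\<^sub>2" "b \<in> E\<^sub>1" for a b
    using meet[OF that(2,1)] by (simp add: Int_commute)
qed (fact finite_left finite_right card_left card_right)+

lemma left_right_disjoint: "E\<^sub>1 \<inter> E\<^sub>2 = {}"
proof -
  have "e \<notin> E\<^sub>2" if "e \<in> E\<^sub>1" for e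
  proof
    assume "e \<in> E\<^sub>2"
    with that have "e \<subseteq> {v}" using meet[of e e] by auto
    then have "card e \<le> card {v}" by (intro card_mono) auto
    then show False using card_left[OF that] by simp
  qed
  then show ?thesis by auto
qed

section \<open>Splitting of 1-cycles at the cut vertex\<close>

lemma edge_cycles_left_subset: "edge_cycles E\<^sub>1 \<subseteq> edge_cycles (E\<^sub>1 \<union> E\<^sub>2)"
  using edge_cycles_mono[of "E\<^sub>1 \<union> E\<^sub>2" E\<^sub>1] finite_left finite_right by auto

text \<open>Away from \<open>v\<close> the edges at a vertex all belong to one side, so the
  restricted function inherits the cycle condition there; only \<open>v\<close> needs an
  argument.\<close>

lemma edge_cycles_restrict_left:
  assumes g: "g \<in> edge_cycles (E\<^sub>1 \<union> E\<^sub>2)"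
  shows "(\<lambda>e. if e \<in> E\<^sub>1 then g e else 0) \<in> edge_cycles E\<^sub>1"
proof -
  define B where "B x = (\<Sum>e\<in>E\<^sub>1. g e * incidence e x)" for x
  have fin: "finite (\<Union>E\<^sub>1)"
    using finite_left card_left card_2_finite by auto
  have other: "B x = 0" if "x \<noteq> v" for x
  proof (cases "x \<in> \<Union>E\<^sub>1")
    case True
    then have "x \<notin> e" if "e \<in> E\<^sub>2" for e
      using that meet \<open>x \<noteq> v\<close> by auto
    then have "(\<Sum>e\<in>E\<^sub>2. g e * incidence e x) = 0"
      using card_right by (intro sum.neutral) (auto simp: incidence_outside)
    moreover have "(\<Sum>e\<in>E\<^sub>1 \<union> E\<^sub>2. g e * incidence e x) = 0"
      using g by (simp add: edge_cycles_def)
    ultimately show ?thesis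
      using sum.union_disjoint[OF finite_left finite_right left_right_disjoint, of "\<lambda>e. g e * incidence e x"]
      by (simp add: B_def)
  next
    case False
    then show ?thesis
      unfolding B_def using card_left by (intro sum.neutral) (auto simp: incidence_outside)
  qed
  \<comment> \<open>The coefficients of a boundary add up to 0, so the one at \<open>v\<close> vanishes with all the others.\<close>
  have "(\<Sum>x\<in>insert v (\<Union>E\<^sub>1). B x) = (\<Sum>e\<in>E\<^sub>1. g e * (\<Sum>x\<in>insert v (\<Union>E\<^sub>1). incidence e x))"
    unfolding B_def by (subst sum.swap) (simp add: sum_distrib_left)
  also have "\<dots> = 0"
    using card_left fin by (intro sum.neutral ballI) (simp add: sum_incidence Sup_upper subset_insertI2)
  finally have "B v + (\<Sum>x\<in>\<Union>E\<^sub>1 - {v}. B x) = 0"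
    using fin by (simp add: sum.insert_remove)
  moreover have "(\<Sum>x\<in>\<Union>E\<^sub>1 - {v}. B x) = 0"
    using other by (intro sum.neutral) auto
  ultimately have "B x = 0" for x
    using other by (cases "x = v") auto
  then show ?thesis
    by (simp add: edge_cycles_def B_def)
qed

section \<open>2-cycles supported on one summand\<close>

lemma pair_cycles_left_subset: "pair_cycles E\<^sub>1 \<subseteq> pair_cycles (E\<^sub>1 \<union> E\<^sub>2)"
proof
  fix f assume f: "f \<in> pair_cycles E\<^sub>1"
  have supp: "f c = 0" if "c \<notin> disjoint_pairs E\<^sub>1" for c
    using f that by (simp add: pair_cycles_def)
  have "(\<lambda>e. orientation e u * f {e, u}) \<in> edge_cycles (E\<^sub>1 \<union> E\<^sub>2)" if u: "u \<in> E\<^sub>1 \<union> E\<^sub>2" for u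
  proof (cases "u \<in> E\<^sub>1")
    case True
    then show ?thesis
      using f edge_cycles_left_subset by (auto simp: pair_cycles_def)
  next
    case False
    then have "f {e, u} = 0" for e
      by (intro supp) (simp add: doubleton_in_disjoint_pairs)
    then show ?thesis by (simp add: edge_cycles_zero)
  qed
  moreover have "f c = 0" if "c \<notin> disjoint_pairs (E\<^sub>1 \<union> E\<^sub>2)" for c
    using that disjoint_pairs_mono[of E\<^sub>1 "E\<^sub>1 \<union> E\<^sub>2"] by (intro supp) auto
  ultimately show "f \<in> pair_cycles (E\<^sub>1 \<union> E\<^sub>2)"
    by (simp add: pair_cycles_def)
qed

lemma pair_cycles_slice_left:
  assumes f: "f \<in> pair_cycles (E\<^sub>1 \<union> E\<^sub>2)" and u: "u \<in> E\<^sub>1 \<union> E\<^sub>2"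
  shows "(\<lambda>e. if e \<in> E\<^sub>1 then orientation e u * f {e, u} else 0) \<in> edge_cycles E\<^sub>1"
  using f u by (intro edge_cycles_restrict_left) (simp add: pair_cycles_def)

lemma pair_cycles_restrict_left:
  assumes f: "f \<in> pair_cycles (E\<^sub>1 \<union> E\<^sub>2)"
  shows "(\<lambda>c. if c \<in> disjoint_pairs E\<^sub>1 then f c else 0) \<in> pair_cycles E\<^sub>1"
proof -
  have "(\<lambda>e. orientation e u * (if {e, u} \<in> disjoint_pairs E\<^sub>1 then f {e, u} else 0)) \<in> edge_cycles E\<^sub>1"
    if u: "u \<in> E\<^sub>1" for u
  proof -
    \<comment> \<open>Meeting pairs carry the value 0 anyway, so restricting to
      \<open>disjoint_pairs E\<^sub>1\<close> restricts each slice to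
      \<open>E\<^sub>1\<close>.\<close>
    have "f {e, u} = 0" if "e \<inter> u \<noteq> {}" for e
      using f that by (simp add: pair_cycles_def doubleton_in_disjoint_pairs)
    then have "(\<lambda>e. orientation e u * (if {e, u} \<in> disjoint_pairs E\<^sub>1 then f {e, u} else 0)) =
        (\<lambda>e. if e \<in> E\<^sub>1 then orientation e u * f {e, u} else 0)"
      using u by (auto simp: doubleton_in_disjoint_pairs)
    then show ?thesis using pair_cycles_slice_left[OF f] u by simp
  qed
  then show ?thesis by (simp add: pair_cycles_def)
qed

section \<open>Mixed 2-cycles\<close>

lemma mixed_pair_function:
  fixes h :: "'a set \<Rightarrow> 'a set \<Rightarrow> int"
  obtains f where "\<And>a b. a \<in> E\<^sub>1 \<Longrightarrow> b \<in> E\<^sub>2 \<Longrightarrow> f {a, b} = h a b"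
    "\<And>c. (\<And>a b. a \<in> E\<^sub>1 \<Longrightarrow> b \<in> E\<^sub>2 \<Longrightarrow> c \<noteq> {a, b}) \<Longrightarrow> f c = 0"
proof
  \<comment> \<open>Since the two edge sets are disjoint, intersecting an unordered mixed pair with
    each of them recovers the two arguments of \<open>h\<close>.\<close>
  define f where "f c = (if \<exists>a\<in>E\<^sub>1. \<exists>b\<in>E\<^sub>2. c = {a, b} then h (the_elem (c \<inter> E\<^sub>1)) (the_elem (c \<inter> E\<^sub>2)) else 0)"
    for c
  show "f {a, b} = h a b" if "a \<in> E\<^sub>1" "b \<in> E\<^sub>2" for a b
  proof -
    have "{a, b} \<inter> E\<^sub>1 = {a}" "{a, b} \<inter> E\<^sub>2 = {b}"
      using that left_right_disjoint by auto
    moreover have "\<exists>a'\<in>E\<^sub>1. \<exists>b'\<in>E\<^sub>2. {a, b} = {a', b'}"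
      using that by blast
    ultimately show ?thesis
      by (simp only: f_def the_elem_eq if_True)
  qed
  show "f c = 0" if "\<And>a b. a \<in> E\<^sub>1 \<Longrightarrow> b \<in> E\<^sub>2 \<Longrightarrow> c \<noteq> {a, b}" for c
    using that by (auto simp: f_def)
qed

text \<open>This realises the tensor product of \<alpha> and \<beta> as a 2-cycle. Edges from
  different sides can meet only in \<open>v\<close>, so \<open>zero\<close> is exactly what makes
  the product vanish on pairs that are no cells.\<close>

lemma pair_cycle_product:
  assumes \<alpha>: "\<alpha> \<in> edge_cycles E\<^sub>1" and \<beta>: "\<beta> \<in> edge_cycles E\<^sub>2"
    and zero: "\<And>a b. a \<in> E\<^sub>1 \<Longrightarrow> b \<in> E\<^sub>2 \<Longrightarrow> v \<in> a \<Longrightarrow> v \<in> b \<Longrightarrow> \<alpha> a * \<beta> b = 0"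
  obtains f where "f \<in> pair_cycles (E\<^sub>1 \<union> E\<^sub>2)"
    "\<And>a b. a \<in> E\<^sub>1 \<Longrightarrow> b \<in> E\<^sub>2 \<Longrightarrow> f {a, b} = orientation a b * \<alpha> a * \<beta> b"
    "\<And>c. (\<And>a b. a \<in> E\<^sub>1 \<Longrightarrow> b \<in> E\<^sub>2 \<Longrightarrow> c \<noteq> {a, b}) \<Longrightarrow> f c = 0"
proof -
  interpret swap: wedge E\<^sub>2 E\<^sub>1 v by (rule wedge_swap)
  obtain f where f: "\<And>a b. a \<in> E\<^sub>1 \<Longrightarrow> b \<in> E\<^sub>2 \<Longrightarrow> f {a, b} = orientation a b * \<alpha> a * \<beta> b"
    and supp: "\<And>c. (\<And>a b. a \<in> E\<^sub>1 \<Longrightarrow> b \<in> E\<^sub>2 \<Longrightarrow> c \<noteq> {a, b}) \<Longrightarrow> f c = 0"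
    using mixed_pair_function[of "\<lambda>a b. orientation a b * \<alpha> a * \<beta> b"] by blast
  have nz: "\<alpha> a * \<beta> b = 0" if "a \<in> E\<^sub>1" "b \<in> E\<^sub>2" "a \<inter> b \<noteq> {}" for a b
    using that meet[of a b] by (intro zero) auto
  have out: "\<alpha> a = 0" if "a \<notin> E\<^sub>1" for a using \<alpha> that by (simp add: edge_cycles_def)
  have out': "\<beta> b = 0" if "b \<notin> E\<^sub>2" for b using \<beta> that by (simp add: edge_cycles_def)
  have "(\<lambda>e. orientation e u * f {e, u}) \<in> edge_cycles (E\<^sub>1 \<union> E\<^sub>2)" if u: "u \<in> E\<^sub>1 \<union> E\<^sub>2" for u
  proof (cases "u \<in> E\<^sub>1")
    case True
    \<comment> \<open>The slice at a left edge \<open>u\<close> is a multiple of \<beta>; the minus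
      sign comes from exchanging the two edges.\<close>
    have "orientation e u * f {e, u} = (- \<alpha> u) * \<beta> e" for e
    proof (cases "e \<in> E\<^sub>2")
      case e: True
      show ?thesis
      proof (cases "u \<inter> e = {}")
        case True
        have "orientation e u = - orientation u e"
          using card_left[OF \<open>u \<in> E\<^sub>1\<close>] card_right[OF e] True by (intro orientation_swap)
        moreover have "f {e, u} = orientation u e * \<alpha> u * \<beta> e"
          using f[OF \<open>u \<in> E\<^sub>1\<close> e] by (simp add: insert_commute)
        ultimately show ?thesis
          by (simp add: mult.assoc orientation_cancel)
      next
        case False
        then show ?thesis
          using f[OF \<open>u \<in> E\<^sub>1\<close> e] nz[OF \<open>u \<in> E\<^sub>1\<close> e] by (auto simp: insert_commute)
      qed
    next
      case e: False
      have "f {e, u} = 0"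
        using e True left_right_disjoint by (intro supp) (auto simp: doubleton_eq_iff)
      then show ?thesis using out'[OF e] by simp
    qed
    then show ?thesis
      using edge_cycles_smult[OF \<beta>, of "- \<alpha> u"] swap.edge_cycles_left_subset
      by (auto simp: Un_commute)
  next
    case False
    with u have u: "u \<in> E\<^sub>2" by simp
    \<comment> \<open>The slice at a right edge \<open>u\<close> is a multiple of \<alpha>, with the
      edges already in the order used to define \<open>f\<close>.\<close>
    have "orientation e u * f {e, u} = \<beta> u * \<alpha> e" for e
    proof (cases "e \<in> E\<^sub>1")
      case True
      then show ?thesis
        using f[OF True u] by (simp add: mult.assoc orientation_cancel mult.commute[of "\<beta> u"])
    next
      case e: False
      have "f {e, u} = 0"
        using e False by (intro supp) (auto simp: doubleton_eq_iff)
      then show ?thesis using out[OF e] by simp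
    qed
    then show ?thesis
      using edge_cycles_smult[OF \<alpha>, of "\<beta> u"] edge_cycles_left_subset by auto
  qed
  moreover have "f c = 0" if c: "c \<notin> disjoint_pairs (E\<^sub>1 \<union> E\<^sub>2)" for c
  proof (cases "\<exists>a\<in>E\<^sub>1. \<exists>b\<in>E\<^sub>2. c = {a, b}")
    case True
    then obtain a b where ab: "a \<in> E\<^sub>1" "b \<in> E\<^sub>2" "c = {a, b}" by blast
    with c have "a \<inter> b \<noteq> {}" by (simp add: doubleton_in_disjoint_pairs)
    with ab f nz show ?thesis by auto
  next
    case False
    then show ?thesis by (intro supp) auto
  qed
  ultimately have "f \<in> pair_cycles (E\<^sub>1 \<union> E\<^sub>2)"
    by (simp add: pair_cycles_def)
  with f supp that show thesis by blast
qed

text \<open>Pivots are used in one argument at a time: for a pivot \<open>p\<close> the slice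
  vanishes on \<open>Q\<close>, hence on all right edges; then for each right edge \<open>b\<close>
  the slice vanishes on \<open>P\<close>, hence on all left edges.\<close>

lemma pair_cycle_mixed_eq_0:
  assumes P: "pivots (edge_cycles E\<^sub>1) E\<^sub>1 P" and Q: "pivots (edge_cycles E\<^sub>2) E\<^sub>2 Q"
    and f: "f \<in> pair_cycles (E\<^sub>1 \<union> E\<^sub>2)" and zero: "\<And>p q. p \<in> P \<Longrightarrow> q \<in> Q \<Longrightarrow> f {p, q} = 0"
    and a: "a \<in> E\<^sub>1" and b: "b \<in> E\<^sub>2"
  shows "f {a, b} = 0"
proof -
  interpret swap: wedge E\<^sub>2 E\<^sub>1 v by (rule wedge_swap)
  have PQ: "P \<subseteq> E\<^sub>1" "Q \<subseteq> E\<^sub>2"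
    using P Q by (auto simp: pivots_def)
  have row: "f {p, b} = 0" if "p \<in> P" "b \<in> E\<^sub>2" for p b
  proof -
    have "(\<lambda>e. if e \<in> E\<^sub>2 then orientation e p * f {e, p} else 0) \<in> edge_cycles E\<^sub>2"
      using f that PQ by (intro swap.pair_cycles_slice_left) (auto simp: Un_commute)
    then have "orientation b p * f {b, p} = 0"
      using pivots_vanish[OF Q, of "\<lambda>e. if e \<in> E\<^sub>2 then orientation e p * f {e, p} else 0" b]
        zero[OF that(1)] that(2) by (auto simp: insert_commute)
    then show ?thesis by (simp add: insert_commute)
  qed
  have "orientation a b * f {a, b} = 0"
    using pivots_vanish[OF P pair_cycles_slice_left[OF f, of b], of a] row a b by auto
  then show ?thesis by simp
qed

abbreviation cut_left :: "'a set set" where "cut_left \<equiv> {e \<in> E\<^sub>1. v \<in> e}"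
abbreviation cut_right :: "'a set set" where "cut_right \<equiv> {e \<in> E\<^sub>2. v \<in> e}"

text \<open>Pairs of pivots that both contain \<open>v\<close> are left out because they are no
  cells. For the remaining pairs, \<open>P'\<close> and \<open>Q'\<close> make one of the two dual
  cycles vanish on all edges at \<open>v\<close>, so their product is a 2-cycle.\<close>

lemma pivots_pair_cycles:
  assumes P: "pivots (edge_cycles E\<^sub>1) E\<^sub>1 P" and P': "pivots (edge_cycles E\<^sub>1) cut_left (P \<inter> cut_left)"
    and Q: "pivots (edge_cycles E\<^sub>2) E\<^sub>2 Q" and Q': "pivots (edge_cycles E\<^sub>2) cut_right (Q \<inter> cut_right)"
    and F\<^sub>1: "pivots (pair_cycles E\<^sub>1) (disjoint_pairs E\<^sub>1) F\<^sub>1"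
    and F\<^sub>2: "pivots (pair_cycles E\<^sub>2) (disjoint_pairs E\<^sub>2) F\<^sub>2"
  defines "M \<equiv> (\<lambda>(p, q). {p, q}) ` (P \<times> Q - (P \<inter> cut_left) \<times> (Q \<inter> cut_right))"
  shows "pivots (pair_cycles (E\<^sub>1 \<union> E\<^sub>2)) (disjoint_pairs (E\<^sub>1 \<union> E\<^sub>2)) (F\<^sub>1 \<union> F\<^sub>2 \<union> M)"
    and "card (F\<^sub>1 \<union> F\<^sub>2 \<union> M) = card F\<^sub>1 + card F\<^sub>2 + card M"
    and "card M + card (P \<inter> cut_left) * card (Q \<inter> cut_right) = card P * card Q"
proof -
  interpret swap: wedge E\<^sub>2 E\<^sub>1 v by (rule wedge_swap)
  let ?E = "E\<^sub>1 \<union> E\<^sub>2"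
  have fin: "finite P" "finite Q" "finite F\<^sub>1" "finite F\<^sub>2" "finite M"
    and PQ: "P \<subseteq> E\<^sub>1" "Q \<subseteq> E\<^sub>2" and F: "F\<^sub>1 \<subseteq> disjoint_pairs E\<^sub>1" "F\<^sub>2 \<subseteq> disjoint_pairs E\<^sub>2"
    using P Q F\<^sub>1 F\<^sub>2 by (auto simp: pivots_def M_def)
  have M: "\<exists>p\<in>P. \<exists>q\<in>Q. c = {p, q} \<and> (v \<notin> p \<or> v \<notin> q)" if "c \<in> M" for c
    using that PQ by (auto simp: M_def)
  have mixed: "{a, b} \<notin> disjoint_pairs E\<^sub>1" "{a, b} \<notin> disjoint_pairs E\<^sub>2" if "a \<in> E\<^sub>1" "b \<in> E\<^sub>2" for a b
    using that left_right_disjoint by (auto simp: doubleton_in_disjoint_pairs)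
  have pure: "c \<notin> disjoint_pairs E\<^sub>2" if "c \<in> disjoint_pairs E\<^sub>1" for c
    using that left_right_disjoint unfolding disjoint_pairs_def by (auto simp: doubleton_eq_iff)
  have FM: "F\<^sub>1 \<inter> F\<^sub>2 = {}" "F\<^sub>1 \<inter> M = {}" "F\<^sub>2 \<inter> M = {}"
    using F pure M mixed PQ by blast+
  show "card (F\<^sub>1 \<union> F\<^sub>2 \<union> M) = card F\<^sub>1 + card F\<^sub>2 + card M"
    using FM fin by (simp add: card_Un_disjoint Int_Un_distrib2)
  have "inj_on (\<lambda>(p, q). {p, q}) (P \<times> Q)"
    using PQ left_right_disjoint by (auto simp: inj_on_def doubleton_eq_iff)
  then have "card M = card (P \<times> Q - (P \<inter> cut_left) \<times> (Q \<inter> cut_right))"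
    unfolding M_def by (intro card_image) (auto intro: inj_on_subset)
  also have "\<dots> = card (P \<times> Q) - card ((P \<inter> cut_left) \<times> (Q \<inter> cut_right))"
    using fin by (intro card_Diff_subset) auto
  finally have "card M = card P * card Q - card (P \<inter> cut_left) * card (Q \<inter> cut_right)"
    by (simp add: card_cartesian_product)
  \<comment> \<open>This inequality lets the truncated difference of naturals be rewritten as a
    sum.\<close>
  moreover have "card (P \<inter> cut_left) * card (Q \<inter> cut_right) \<le> card P * card Q"
    using fin by (intro mult_le_mono card_mono) auto
  ultimately show "card M + card (P \<inter> cut_left) * card (Q \<inter> cut_right) = card P * card Q"
    by simp
  have "M \<subseteq> disjoint_pairs ?E"
  proof
    fix c assume "c \<in> M"
    then obtain p q where "p \<in> P" "q \<in> Q" "c = {p, q}" "v \<notin> p \<or> v \<notin> q" using M by blast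
    moreover from this have "p \<inter> q \<subseteq> {v}" using PQ by (intro meet) auto
    ultimately show "c \<in> disjoint_pairs ?E"
      using PQ by (auto simp: doubleton_in_disjoint_pairs)
  qed
  then have sub: "F\<^sub>1 \<union> F\<^sub>2 \<union> M \<subseteq> disjoint_pairs ?E"
    using F disjoint_pairs_mono[of E\<^sub>1 ?E] disjoint_pairs_mono[of E\<^sub>2 ?E] by blast
  have vanish: "f c = 0"
    if f: "f \<in> pair_cycles ?E" and z: "\<And>d. d \<in> F\<^sub>1 \<union> F\<^sub>2 \<union> M \<Longrightarrow> f d = 0" and c: "c \<in> disjoint_pairs ?E" for f c
  proof -
    obtain s t where st: "c = {s, t}" "s \<in> ?E" "t \<in> ?E" "s \<inter> t = {}"
      using c unfolding disjoint_pairs_def by blast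
    have f0: "f {s, t} = 0" if "s \<inter> t \<noteq> {}" for s t
      using f that by (simp add: pair_cycles_def doubleton_in_disjoint_pairs)
    have "f {p, q} = 0" if "p \<in> P" "q \<in> Q" for p q
    proof (cases "v \<in> p \<and> v \<in> q")
      case True
      then show ?thesis by (intro f0) auto
    next
      case False
      with that have "{p, q} \<in> M" by (auto simp: M_def intro!: image_eqI[of _ _ "(p, q)"])
      then show ?thesis by (simp add: z)
    qed
    then have mix: "f {a, b} = 0" if "a \<in> E\<^sub>1" "b \<in> E\<^sub>2" for a b
      using pair_cycle_mixed_eq_0[OF P Q f] that by blast
    have left: "f c = 0" if "c \<in> disjoint_pairs E\<^sub>1"
      using pivots_vanish[OF F\<^sub>1 pair_cycles_restrict_left[OF f] _ that] z that by auto
    have "f \<in> pair_cycles (E\<^sub>2 \<union> E\<^sub>1)" using f by (simp add: Un_commute)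
    from pivots_vanish[OF F\<^sub>2 swap.pair_cycles_restrict_left[OF this]]
    have right: "f c = 0" if "c \<in> disjoint_pairs E\<^sub>2"
      using z that by auto
    show ?thesis
      using st mix[of s t] mix[of t s] left right
      by (auto simp: doubleton_in_disjoint_pairs insert_commute)
  qed
  have dual: "\<exists>g\<in>pair_cycles ?E. g c \<noteq> 0 \<and> (\<forall>d\<in>F\<^sub>1 \<union> F\<^sub>2 \<union> M - {c}. g d = 0)"
    if "c \<in> F\<^sub>1 \<union> F\<^sub>2 \<union> M" for c
  proof -
    consider "c \<in> F\<^sub>1" | "c \<in> F\<^sub>2" | "c \<in> M" using \<open>c \<in> F\<^sub>1 \<union> F\<^sub>2 \<union> M\<close> by blast
    then show ?thesis
    proof cases
      case 1
      then obtain g where g: "g \<in> pair_cycles E\<^sub>1" "g c \<noteq> 0" "\<And>d. d \<in> F\<^sub>1 \<Longrightarrow> d \<noteq> c \<Longrightarrow> g d = 0"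
        using pivots_dual[OF F\<^sub>1] by blast
      have "g d = 0" if "d \<in> F\<^sub>2 \<union> M" for d
      proof -
        have "d \<notin> disjoint_pairs E\<^sub>1" using that F pure M mixed PQ by blast
        with g(1) show ?thesis by (simp add: pair_cycles_def)
      qed
      with g pair_cycles_left_subset show ?thesis by blast
    next
      case 2
      then obtain g where g: "g \<in> pair_cycles E\<^sub>2" "g c \<noteq> 0" "\<And>d. d \<in> F\<^sub>2 \<Longrightarrow> d \<noteq> c \<Longrightarrow> g d = 0"
        using pivots_dual[OF F\<^sub>2] by blast
      have "g d = 0" if "d \<in> F\<^sub>1 \<union> M" for d
      proof -
        have "d \<notin> disjoint_pairs E\<^sub>2" using that F pure M mixed PQ by blast
        with g(1) show ?thesis by (simp add: pair_cycles_def)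
      qed
      moreover have "g \<in> pair_cycles ?E"
        using g(1) swap.pair_cycles_left_subset by (auto simp: Un_commute)
      ultimately show ?thesis using g by blast
    next
      case 3
      then obtain p q where pq: "p \<in> P" "q \<in> Q" "c = {p, q}" "v \<notin> p \<or> v \<notin> q" using M by blast
      obtain \<alpha> where \<alpha>: "\<alpha> \<in> edge_cycles E\<^sub>1" "\<alpha> p \<noteq> 0" "\<And>r. r \<in> P \<Longrightarrow> r \<noteq> p \<Longrightarrow> \<alpha> r = 0"
        using pivots_dual[OF P pq(1)] by blast
      obtain \<beta> where \<beta>: "\<beta> \<in> edge_cycles E\<^sub>2" "\<beta> q \<noteq> 0" "\<And>r. r \<in> Q \<Longrightarrow> r \<noteq> q \<Longrightarrow> \<beta> r = 0"
        using pivots_dual[OF Q pq(2)] by blast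
      \<comment> \<open>If \<open>q\<close> avoids \<open>v\<close>, then \<beta> is 0 at every
        pivot in \<open>cut_right\<close>, and by \<open>Q'\<close> on all of
        \<open>cut_right\<close>; likewise for \<open>p\<close> and \<alpha>.\<close>
      have "\<alpha> a * \<beta> b = 0" if "a \<in> E\<^sub>1" "b \<in> E\<^sub>2" "v \<in> a" "v \<in> b" for a b
      proof (cases "v \<in> p")
        case True
        with pq have "v \<notin> q" by simp
        then have "\<beta> b = 0"
          using that \<beta> by (intro pivots_vanish[OF Q', of \<beta> b]) auto
        then show ?thesis by simp
      next
        case False
        then have "\<alpha> a = 0"
          using that \<alpha> by (intro pivots_vanish[OF P', of \<alpha> a]) auto
        then show ?thesis by simp
      qed
      then obtain g where g: "g \<in> pair_cycles ?E"
        "\<And>a b. a \<in> E\<^sub>1 \<Longrightarrow> b \<in> E\<^sub>2 \<Longrightarrow> g {a, b} = orientation a b * \<alpha> a * \<beta> b"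
        "\<And>c. (\<And>a b. a \<in> E\<^sub>1 \<Longrightarrow> b \<in> E\<^sub>2 \<Longrightarrow> c \<noteq> {a, b}) \<Longrightarrow> g c = 0"
        using pair_cycle_product[OF \<alpha>(1) \<beta>(1)] by blast
      have "p \<in> E\<^sub>1" "q \<in> E\<^sub>2" using pq PQ by auto
      then have "g c \<noteq> 0"
        using g(2)[of p q] pq(3) \<alpha>(2) \<beta>(2) by simp
      moreover have "g d = 0" if d: "d \<in> F\<^sub>1 \<union> F\<^sub>2 \<union> M" "d \<noteq> c" for d
      proof (cases "d \<in> M")
        case True
        then obtain p' q' where d': "p' \<in> P" "q' \<in> Q" "d = {p', q'}" using M by blast
        with d pq have "p' \<noteq> p \<or> q' \<noteq> q" by auto
        with d' \<alpha>(3) \<beta>(3) have "\<alpha> p' * \<beta> q' = 0" by auto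
        moreover have "p' \<in> E\<^sub>1" "q' \<in> E\<^sub>2" using d' PQ by auto
        ultimately show ?thesis using g(2)[of p' q'] d'(3) by auto
      next
        case False
        with d F have "d \<in> disjoint_pairs E\<^sub>1 \<or> d \<in> disjoint_pairs E\<^sub>2" by blast
        then show ?thesis using mixed by (intro g(3)) blast
      qed
      ultimately show ?thesis using g(1) by blast
    qed
  qed
  show "pivots (pair_cycles ?E) (disjoint_pairs ?E) (F\<^sub>1 \<union> F\<^sub>2 \<union> M)"
    unfolding pivots_def
  proof (intro conjI ballI impI)
    show "finite (F\<^sub>1 \<union> F\<^sub>2 \<union> M)" using fin by simp
    show "F\<^sub>1 \<union> F\<^sub>2 \<union> M \<subseteq> disjoint_pairs ?E" by (rule sub)
    show "f c = 0" if "f \<in> pair_cycles ?E" "\<forall>p\<in>F\<^sub>1 \<union> F\<^sub>2 \<union> M. f p = 0" "c \<in> disjoint_pairs ?E" for f c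
      using that(2) by (intro vanish[OF that(1) _ that(3)]) blast
    show "\<exists>g\<in>pair_cycles ?E. g c \<noteq> 0 \<and> (\<forall>d\<in>F\<^sub>1 \<union> F\<^sub>2 \<union> M - {c}. g d = 0)"
      if "c \<in> F\<^sub>1 \<union> F\<^sub>2 \<union> M" for c
      using that by (rule dual)
  qed
qed

end

section \<open>Deletion of the cut vertex\<close>

lemma edge_cycles_remove_cut:
  assumes "finite E"
  shows "edge_cycles {e \<in> E. v \<notin> e} = {f \<in> edge_cycles E. \<forall>e\<in>{e \<in> E. v \<in> e}. f e = 0}"
proof -
  have "E - {e \<in> E. v \<notin> e} = {e \<in> E. v \<in> e}" by auto
  then show ?thesis
    using edge_cycles_mono[of E "{e \<in> E. v \<notin> e}"] assms by auto
qed

text \<open>A single set of pivots serves the graph, its edges at \<open>v\<close> and the graph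
  without \<open>v\<close>, so the first Betti number splits into pivots at \<open>v\<close> and
  pivots away from \<open>v\<close>.\<close>

lemma pivots_cut:
  assumes fin: "finite E"
  obtains P where "pivots (edge_cycles E) E P"
    "pivots (edge_cycles E) {e \<in> E. v \<in> e} (P \<inter> {e \<in> E. v \<in> e})"
    "pivots (edge_cycles {e \<in> E. v \<notin> e}) {e \<in> E. v \<notin> e} (P - {e \<in> E. v \<in> e})"
proof -
  let ?R = "{e \<in> E. v \<in> e}" and ?S = "{e \<in> E. v \<notin> e}"
  obtain P where P: "pivots (edge_cycles E) E P" "pivots (edge_cycles E) ?R (P \<inter> ?R)"
    "pivots {f \<in> edge_cycles E. \<forall>x\<in>?R. f x = 0} E (P - ?R)"
    using pivots_adapted[OF int_submodule_edge_cycles fin, of ?R] by blast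
  from P(3) have "pivots (edge_cycles ?S) E (P - ?R)"
    unfolding edge_cycles_remove_cut[OF fin] .
  then have "pivots (edge_cycles ?S) ?S (P - ?R)"
    by (auto simp: pivots_def)
  with P that show thesis by blast
qed

section \<open>The subdivided graph\<close>

text \<open>Reduces the hypothesis on components to a statement about arc ends: an arc between
  \<open>C1\<close> and \<open>C2\<close> would merge two components of the graph without
  \<open>v\<close>.\<close>

lemma one_connected_two_arcs:
  assumes "one_connected_two G v G1 G2"
  obtains C1 C2 where "C1 \<inter> C2 = {}" "v \<notin> C1" "v \<notin> C2"
    "arcs_ends G = arcs_ends G1 \<union> arcs_ends G2"
    "arcs_ends G1 \<subseteq> insert v C1 \<times> insert v C1" "arcs_ends G2 \<subseteq> insert v C2 \<times> insert v C2"
proof -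
  let ?H = "pre_digraph.del_vert G v"
  obtain C1 C2 where G: "graph G" and C: "C1 \<noteq> C2" "pre_digraph.sccs_verts ?H = {C1, C2}"
    and G12: "G1 = G \<restriction> insert v C1" "G2 = G \<restriction> insert v C2"
    using assms by (auto simp: one_connected_two_def)
  interpret G: graph G by (rule G)
  interpret H: wf_digraph ?H by (rule G.wf_digraph_del_vert)
  have disj: "C1 \<inter> C2 = {}"
    using H.sccs_verts_disjoint[of C1 C2] C by simp
  have sub: "C1 \<union> C2 \<subseteq> verts G - {v}"
    using H.sccs_verts_subsets C(2) by (auto simp: G.verts_del_vert)
  have "verts G - {v} \<subseteq> C1 \<union> C2"
  proof
    fix x assume "x \<in> verts G - {v}"
    then have x: "x \<in> verts ?H" by (simp add: G.verts_del_vert)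
    then have "pre_digraph.scc_of ?H x \<in> {C1, C2}"
      using H.scc_of_in_sccs_verts C(2) by simp
    moreover have "x \<in> pre_digraph.scc_of ?H x"
      using H.in_scc_of_self[OF x] .
    ultimately show "x \<in> C1 \<union> C2" by auto
  qed
  with sub have cover: "C1 \<union> C2 = verts G - {v}" by blast
  \<comment> \<open>The reverse arc exists by symmetry, so adjacent vertices other than
    \<open>v\<close> reach each other without passing \<open>v\<close> and share a strongly
    connected component.\<close>
  have closed: "y \<in> S" if S: "S \<in> {C1, C2}" and xy: "(x, y) \<in> arcs_ends G" "x \<noteq> v" "y \<noteq> v" and x: "x \<in> S" for x y S
  proof -
    have H: "(a, b) \<in> arcs_ends ?H" if "(a, b) \<in> arcs_ends G" "a \<noteq> v" "b \<noteq> v" for a b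
      using that by (auto simp: arcs_ends_conv G.arcs_del_vert G.tail_del_vert G.head_del_vert)
    have "(y, x) \<in> arcs_ends G"
      using arcs_ends_symmetric[OF G.sym_arcs xy(1)] .
    then have "x \<rightarrow>\<^sup>*\<^bsub>?H\<^esub> y" "y \<rightarrow>\<^sup>*\<^bsub>?H\<^esub> x"
      using H xy by (auto intro: H.adj_in_verts H.reachable_adjI)
    then show ?thesis
      using S C(2) x H.in_sccs_verts_conv_reachable[of S] by blast
  qed
  have ends: "arcs_ends (G \<restriction> insert v S) = arcs_ends G \<inter> insert v S \<times> insert v S" for S
    by (auto simp: arcs_ends_conv)
  have "(x, y) \<in> insert v C1 \<times> insert v C1 \<or> (x, y) \<in> insert v C2 \<times> insert v C2"
    if xy: "(x, y) \<in> arcs_ends G" for x y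
  proof -
    have "x \<in> insert v (C1 \<union> C2)" "y \<in> insert v (C1 \<union> C2)"
      using G.adj_in_verts[OF xy] cover by auto
    then show ?thesis
      using closed[OF _ xy, of C1] closed[OF _ xy, of C2] by auto
  qed
  then have "arcs_ends G = arcs_ends G1 \<union> arcs_ends G2"
    by (auto simp: G12 ends)
  moreover have "arcs_ends G1 \<subseteq> insert v C1 \<times> insert v C1" "arcs_ends G2 \<subseteq> insert v C2 \<times> insert v C2"
    by (auto simp: G12 ends)
  ultimately show thesis
    using that[of C1 C2] disj sub by blast
qed

section \<open>Edge sets after subdivision\<close>

definition subdivided_edges :: "'a \<Rightarrow> ('a \<times> 'a) set \<Rightarrow> ('a \<times> bool) set set" where
  "subdivided_edges v A = {{(x, False), (y, False)} | x y. (x, y) \<in> A \<and> x \<noteq> v \<and> y \<noteq> v}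
     \<union> {{(v, False), (w, True)} | w. (v, w) \<in> A} \<union> {{(w, True), (w, False)} | w. (v, w) \<in> A}"

lemma graph_cells_subdivide_at:
  "graph_cells (subdivide_at v G) 1 = subdivided_edges v (arcs_ends G)" (is "?L = ?R")
proof
  show "?L \<subseteq> ?R"
    by (auto simp: graph_cells_def subdivide_at_def subdivided_edges_def insert_commute)
next
  have arc: "{s, t} \<in> ?L" if "(s, t) \<in> arcs (subdivide_at v G)" for s t
  proof -
    have "{s, t} = {tail (subdivide_at v G) (s, t), head (subdivide_at v G) (s, t)}"
      by (simp add: subdivide_at_def)
    with that show ?thesis by (simp add: graph_cells_def del: split_paired_Ex) blast
  qed
  show "?R \<subseteq> ?L"
    unfolding subdivided_edges_def by (auto simp del: One_nat_def intro!: arc) (auto simp: subdivide_at_def)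
qed

lemma graph_cells_del_vert:
  "graph_cells (pre_digraph.del_vert G v) 1 = {e \<in> graph_cells G 1. v \<notin> e}"
  by (auto simp: graph_cells_def pre_digraph.del_vert_def)

text \<open>Carries the splitting of the original graph over to its subdivision.\<close>

lemma subdivided_edges_Un: "subdivided_edges v (A \<union> B) = subdivided_edges v A \<union> subdivided_edges v B"
  unfolding subdivided_edges_def by blast

lemma finite_subdivided_edges:
  assumes "finite A"
  shows "finite (subdivided_edges v A)"
proof -
  have "subdivided_edges v A \<subseteq> Pow (insert v (Field A) \<times> UNIV)"
    by (auto simp: subdivided_edges_def Field_def)
  with assms show ?thesis by (auto intro: finite_subset simp: finite_Field)
qed

lemma card_subdivided_edges:
  assumes "\<And>x. (x, x) \<notin> A" "e \<in> subdivided_edges v A"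
  shows "card e = 2"
proof -
  have "\<exists>s t. e = {s, t} \<and> s \<noteq> t"
    using assms unfolding subdivided_edges_def by blast
  then show ?thesis by auto
qed

text \<open>A midpoint is named after the neighbour of \<open>v\<close>, which lies in
  \<open>C\<close> since there is no loop at \<open>v\<close>. Hence the subdivisions of two sides
  with disjoint \<open>C\<close> share no vertex but \<open>v\<close>.\<close>

lemma subdivided_edges_subset:
  assumes "A \<subseteq> insert v C \<times> insert v C" "\<And>x. (x, x) \<notin> A" "e \<in> subdivided_edges v A"
  shows "e \<subseteq> insert (v, False) (C \<times> UNIV)"
  using assms unfolding subdivided_edges_def by blast

theorem mainTheorem2:
  fixes G0 G0\<^sub>1 G0\<^sub>2 :: "('a::linorder, 'b) pre_digraph"
    and v0 :: 'a
  assumes "one_connected_two G0 v0 G0\<^sub>1 G0\<^sub>2"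
  defines "v \<equiv> (v0, False)"
    and "\<Gamma> \<equiv> subdivide_at v0 G0"
    and "\<Gamma>\<^sub>1 \<equiv> subdivide_at v0 G0\<^sub>1"
    and "\<Gamma>\<^sub>2 \<equiv> subdivide_at v0 G0\<^sub>2"
  defines "\<Gamma>t\<^sub>1 \<equiv> pre_digraph.del_vert \<Gamma>\<^sub>1 v"
    and "\<Gamma>t\<^sub>2 \<equiv> pre_digraph.del_vert \<Gamma>\<^sub>2 v"
  shows "int (betti 2 (D2 \<Gamma>)) =
      int (betti 2 (D2 \<Gamma>\<^sub>1)) + int (betti 2 (D2 \<Gamma>\<^sub>2))
      + int (betti 1 (graph_complex \<Gamma>t\<^sub>1)) * int (betti 1 (graph_complex \<Gamma>\<^sub>2))
      + int (betti 1 (graph_complex \<Gamma>\<^sub>1)) * int (betti 1 (graph_complex \<Gamma>t\<^sub>2))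
      - int (betti 1 (graph_complex \<Gamma>t\<^sub>1)) * int (betti 1 (graph_complex \<Gamma>t\<^sub>2))"
proof -
  let ?A = "arcs_ends G0" and ?A\<^sub>1 = "arcs_ends G0\<^sub>1" and ?A\<^sub>2 = "arcs_ends G0\<^sub>2"
  define E\<^sub>1 where "E\<^sub>1 = subdivided_edges v0 ?A\<^sub>1"
  define E\<^sub>2 where "E\<^sub>2 = subdivided_edges v0 ?A\<^sub>2"
  obtain C\<^sub>1 C\<^sub>2 where C: "C\<^sub>1 \<inter> C\<^sub>2 = {}" "v0 \<notin> C\<^sub>1" "v0 \<notin> C\<^sub>2" and A: "?A = ?A\<^sub>1 \<union> ?A\<^sub>2"
    and A\<^sub>1: "?A\<^sub>1 \<subseteq> insert v0 C\<^sub>1 \<times> insert v0 C\<^sub>1" and A\<^sub>2: "?A\<^sub>2 \<subseteq> insert v0 C\<^sub>2 \<times> insert v0 C\<^sub>2"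
    using one_connected_two_arcs[OF assms(1)] .
  have "graph G0" using assms(1) by (simp add: one_connected_two_def)
  then interpret G0: graph G0 .
  have fin: "finite ?A\<^sub>1" "finite ?A\<^sub>2" and loop: "(x, x) \<notin> ?A\<^sub>1" "(x, x) \<notin> ?A\<^sub>2" for x
  proof -
    have "finite ?A" by (simp add: arcs_ends_def)
    with A show "finite ?A\<^sub>1" "finite ?A\<^sub>2" by simp_all
    have "(x, x) \<notin> ?A" using G0.adj_not_same by blast
    with A show "(x, x) \<notin> ?A\<^sub>1" "(x, x) \<notin> ?A\<^sub>2" by simp_all
  qed
  have cells: "graph_cells \<Gamma> 1 = E\<^sub>1 \<union> E\<^sub>2" "graph_cells \<Gamma>\<^sub>1 1 = E\<^sub>1" "graph_cells \<Gamma>\<^sub>2 1 = E\<^sub>2"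
    "graph_cells \<Gamma>t\<^sub>1 1 = {e \<in> E\<^sub>1. v \<notin> e}" "graph_cells \<Gamma>t\<^sub>2 1 = {e \<in> E\<^sub>2. v \<notin> e}"
    unfolding \<Gamma>_def \<Gamma>\<^sub>1_def \<Gamma>\<^sub>2_def \<Gamma>t\<^sub>1_def \<Gamma>t\<^sub>2_def E\<^sub>1_def E\<^sub>2_def
      graph_cells_del_vert graph_cells_subdivide_at A subdivided_edges_Un by (rule refl)+
  interpret wedge E\<^sub>1 E\<^sub>2 v
  proof
    show "finite E\<^sub>1" "finite E\<^sub>2"
      unfolding E\<^sub>1_def E\<^sub>2_def using fin by (simp_all add: finite_subdivided_edges)
    show "card e = 2" if "e \<in> E\<^sub>1" for e
      using card_subdivided_edges[OF loop(1)] that by (simp add: E\<^sub>1_def)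
    show "card e = 2" if "e \<in> E\<^sub>2" for e
      using card_subdivided_edges[OF loop(2)] that by (simp add: E\<^sub>2_def)
    show "a \<inter> b \<subseteq> {v}" if "a \<in> E\<^sub>1" "b \<in> E\<^sub>2" for a b
    proof -
      have "a \<subseteq> insert v (C\<^sub>1 \<times> UNIV)" "b \<subseteq> insert v (C\<^sub>2 \<times> UNIV)"
        using subdivided_edges_subset[OF A\<^sub>1 loop(1)] subdivided_edges_subset[OF A\<^sub>2 loop(2)] that
        by (simp_all add: E\<^sub>1_def E\<^sub>2_def v_def)
      with C(1) show ?thesis by blast
    qed
  qed
  obtain P where P: "pivots (edge_cycles E\<^sub>1) E\<^sub>1 P" "pivots (edge_cycles E\<^sub>1) cut_left (P \<inter> cut_left)"
    "pivots (edge_cycles {e \<in> E\<^sub>1. v \<notin> e}) {e \<in> E\<^sub>1. v \<notin> e} (P - cut_left)"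
    using pivots_cut[OF finite_left] .
  obtain Q where Q: "pivots (edge_cycles E\<^sub>2) E\<^sub>2 Q" "pivots (edge_cycles E\<^sub>2) cut_right (Q \<inter> cut_right)"
    "pivots (edge_cycles {e \<in> E\<^sub>2. v \<notin> e}) {e \<in> E\<^sub>2. v \<notin> e} (Q - cut_right)"
    using pivots_cut[OF finite_right] .
  obtain F\<^sub>1 where F\<^sub>1: "pivots (pair_cycles E\<^sub>1) (disjoint_pairs E\<^sub>1) F\<^sub>1"
    using pivots_exist[OF int_submodule_pair_cycles finite_disjoint_pairs[OF finite_left]] .
  obtain F\<^sub>2 where F\<^sub>2: "pivots (pair_cycles E\<^sub>2) (disjoint_pairs E\<^sub>2) F\<^sub>2"
    using pivots_exist[OF int_submodule_pair_cycles finite_disjoint_pairs[OF finite_right]] .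
  note F = pivots_pair_cycles[OF P(1,2) Q(1,2) F\<^sub>1 F\<^sub>2]
  have "betti 2 (D2 \<Gamma>\<^sub>1) = card F\<^sub>1" "betti 2 (D2 \<Gamma>\<^sub>2) = card F\<^sub>2"
    by (rule betti_D2; use F\<^sub>1 F\<^sub>2 finite_left finite_right card_left card_right in \<open>simp add: cells[simplified]\<close>)+
  moreover have "int (betti 2 (D2 \<Gamma>)) = int (card F\<^sub>1) + int (card F\<^sub>2)
      + int (card P) * int (card Q) - int (card (P \<inter> cut_left)) * int (card (Q \<inter> cut_right))"
  proof -
    note F(1)
    moreover have "card e = 2" if "e \<in> graph_cells \<Gamma> 1" for e
      using that card_left card_right unfolding cells by blast
    moreover have "finite (graph_cells \<Gamma> 1)"
      unfolding cells using finite_left finite_right by simp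
    ultimately have "betti 2 (D2 \<Gamma>) = card F\<^sub>1 + card F\<^sub>2 + card ((\<lambda>(p, q). {p, q}) ` (P \<times> Q - (P \<inter> cut_left) \<times> (Q \<inter> cut_right)))"
      unfolding F(2)[symmetric] by (intro betti_D2) (simp_all only: cells)
    with F(3) show ?thesis by (simp flip: of_nat_add of_nat_mult)
  qed
  moreover have "betti 1 (graph_complex \<Gamma>\<^sub>1) = card P" "betti 1 (graph_complex \<Gamma>\<^sub>2) = card Q"
    "betti 1 (graph_complex \<Gamma>t\<^sub>1) = card (P - cut_left)" "betti 1 (graph_complex \<Gamma>t\<^sub>2) = card (Q - cut_right)"
    by (rule betti_graph_complex; use P Q finite_left finite_right card_left card_right in \<open>simp add: cells[simplified]\<close>)+
  \<comment> \<open>With \<open>b\<close> pivots in all and \<open>b'\<close> away from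
    \<open>v\<close> on each side, these equations expand
    \<open>b1 b2 - (b1 - b1') (b2 - b2')\<close> into
    \<open>b1' b2 + b1 b2' - b1' b2'\<close>.\<close>
  moreover have "int (card P) = int (card (P - cut_left)) + int (card (P \<inter> cut_left))"
    "int (card Q) = int (card (Q - cut_right)) + int (card (Q \<inter> cut_right))"
    using P(1) Q(1) card_Int_Diff[of P cut_left] card_Int_Diff[of Q cut_right] by (simp_all add: pivots_def)
  ultimately show ?thesis
    by (simp add: algebra_simps)
qed

end
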